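(* Let $S$ be a torsion-free orthodox semigroup, and let $\Phi$ be a lattice isomorphism of $S$ onto a semigroup $T$, that is, an isomorphism of the lattice $\operatorname{Sub}(S)$ onto the lattice $\operatorname{Sub}(T)$. Then $T$ is also a torsion-free orthodox semigroup. Thus the class of all torsion-free orthodox semigroups is lattice closed.
   Context: For a semigroup $S$, $\operatorname{Sub}(S)$ denotes the set of all subsemigroups of $S$, where by convention the empty set is counted as a subsemigroup, ordered by inclusion; it is a lattice. Two semigroups $S$ and $T$ are lattice isomorphic if $\operatorname{Sub}(S)\cong\operatorname{Sub}(T)$, and any isomorphism of $\operatorname{Sub}(S)$ onto $\operatorname{Sub}(T)$ is called a lattice isomorphism of $S$ onto $T$. A class $\mathcal{K}$ of semigroups is lattice closed (in the class of all semigroups) if $\mathcal{K}$ contains every semigroup which is lattice isomorphic to some semigroup belonging to $\mathcal{K}$. An element $x$ of a semigroup $S$ has infinite order if the cyclic subsemigroup $\langle x\rangle=\{x^n : n\geq 1\}$ generated by $x$ is infinite. A semigroup is torsion-free if every nonidempotent element of it has infinite order. A semigroup $S$ is regular if for every $x\in S$ there is $x'\in S$ with $xx'x=x$. An orthodox semigroup is a regular semigroup whose idempotents form a subsemigroup. *)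

theory Defs
  imports "HOL-Algebra.Lattice"
begin

record 'a sgrp = "'a partial_object" +
  smul :: "'a \<Rightarrow> 'a \<Rightarrow> 'a" (infixl "\<cdot>\<index>" 70)

text \<open>The operation is unconstrained outside the carrier. The empty semigroup is not excluded,
  in line with the convention that the empty set counts as a subsemigroup.\<close>

locale semigrp =
  fixes S :: "'a sgrp" (structure)
  assumes smul_closed: "\<lbrakk>x \<in> carrier S; y \<in> carrier S\<rbrakk> \<Longrightarrow> x \<cdot> y \<in> carrier S"
    and smul_assoc:
      "\<lbrakk>x \<in> carrier S; y \<in> carrier S; z \<in> carrier S\<rbrakk> \<Longrightarrow> (x \<cdot> y) \<cdot> z = x \<cdot> (y \<cdot> z)"

definition subsemigrp :: "'a set \<Rightarrow> 'a sgrp \<Rightarrow> bool" where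
  "subsemigrp A S \<longleftrightarrow> A \<subseteq> carrier S \<and> (\<forall>x\<in>A. \<forall>y\<in>A. x \<cdot>\<^bsub>S\<^esub> y \<in> A)"

definition Sub :: "'a sgrp \<Rightarrow> 'a set gorder" where
  "Sub S = \<lparr>carrier = {A. subsemigrp A S}, eq = (=), le = (\<subseteq>)\<rparr>"

text \<open>Isomorphisms of lattices, the lattices being given as partially ordered sets;
  \<open>lattice_iso_iff_join_meet\<close> below compares this with preservation of joins and meets.\<close>

definition lattice_iso :: "'a gorder \<Rightarrow> 'b gorder \<Rightarrow> ('a \<Rightarrow> 'b) \<Rightarrow> bool" where
  "lattice_iso L M f \<longleftrightarrow> bij_betw f (carrier L) (carrier M) \<and>
     (\<forall>x\<in>carrier L. \<forall>y\<in>carrier L. x \<sqsubseteq>\<^bsub>L\<^esub> y \<longleftrightarrow> f x \<sqsubseteq>\<^bsub>M\<^esub> f y)"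

definition lattice_isomorphism :: "'a sgrp \<Rightarrow> 'b sgrp \<Rightarrow> ('a set \<Rightarrow> 'b set) \<Rightarrow> bool" where
  "lattice_isomorphism S T \<Phi> \<longleftrightarrow> lattice_iso (Sub S) (Sub T) \<Phi>"

definition lattice_isomorphic :: "'a sgrp \<Rightarrow> 'b sgrp \<Rightarrow> bool" where
  "lattice_isomorphic S T \<longleftrightarrow> (\<exists>\<Phi>. lattice_isomorphism S T \<Phi>)"

text \<open>A class of semigroups is a predicate that is polymorphic in the element type. As HOL cannot
  quantify over types, \<open>lattice_closed\<close> takes the instances \<open>K\<close> and \<open>K'\<close> of one and the same class
  at two types; closedness of the class is the statement for arbitrary \<open>'a\<close> and \<open>'b\<close>.\<close>

definition lattice_closed :: "('a sgrp \<Rightarrow> bool) \<Rightarrow> ('b sgrp \<Rightarrow> bool) \<Rightarrow> bool" where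
  "lattice_closed K K' \<longleftrightarrow>
     (\<forall>S T. K S \<and> semigrp T \<and> lattice_isomorphic S T \<longrightarrow> K' T)"

text \<open>\<open>spow_Suc S x n\<close> is the power of \<open>x\<close> with exponent \<open>n + 1\<close>.\<close>

primrec spow_Suc :: "'a sgrp \<Rightarrow> 'a \<Rightarrow> nat \<Rightarrow> 'a" where
  "spow_Suc S x 0 = x"
| "spow_Suc S x (Suc n) = spow_Suc S x n \<cdot>\<^bsub>S\<^esub> x"

definition cyclic_sub :: "'a sgrp \<Rightarrow> 'a \<Rightarrow> 'a set" where
  "cyclic_sub S x = range (spow_Suc S x)"

definition infinite_order :: "'a sgrp \<Rightarrow> 'a \<Rightarrow> bool" where
  "infinite_order S x \<longleftrightarrow> infinite (cyclic_sub S x)"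

definition idempotents :: "'a sgrp \<Rightarrow> 'a set" where
  "idempotents S = {e \<in> carrier S. e \<cdot>\<^bsub>S\<^esub> e = e}"

definition torsion_free :: "'a sgrp \<Rightarrow> bool" where
  "torsion_free S \<longleftrightarrow> semigrp S \<and> (\<forall>x \<in> carrier S - idempotents S. infinite_order S x)"

definition regular_semigrp :: "'a sgrp \<Rightarrow> bool" where
  "regular_semigrp S \<longleftrightarrow> semigrp S \<and>
     (\<forall>x\<in>carrier S. \<exists>x'\<in>carrier S. x \<cdot>\<^bsub>S\<^esub> x' \<cdot>\<^bsub>S\<^esub> x = x)"

definition orthodox_semigrp :: "'a sgrp \<Rightarrow> bool" where
  "orthodox_semigrp S \<longleftrightarrow> regular_semigrp S \<and> subsemigrp (idempotents S) S"

definition torsion_free_orthodox :: "'a sgrp \<Rightarrow> bool" where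
  "torsion_free_orthodox S \<longleftrightarrow> torsion_free S \<and> orthodox_semigrp S"

lemma (in semigrp) Sub_lattice: "lattice (Sub S)"
proof -
  interpret partial_order "Sub S"
    by unfold_locales (auto simp: Sub_def)
  show ?thesis
  proof unfold_locales
    fix A B assume AB: "A \<in> carrier (Sub S)" "B \<in> carrier (Sub S)"
    let ?J = "\<Inter>{C. subsemigrp C S \<and> A \<union> B \<subseteq> C}"
    have top: "subsemigrp (carrier S) S" "A \<union> B \<subseteq> carrier S"
      using AB smul_closed by (auto simp: Sub_def subsemigrp_def)
    have "subsemigrp ?J S"
    proof (rule subsemigrp_def[THEN iffD2], intro conjI ballI)
      show "?J \<subseteq> carrier S" using top by blast
      fix x y assume "x \<in> ?J" "y \<in> ?J"
      then show "x \<cdot> y \<in> ?J" by (auto simp: subsemigrp_def)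
    qed
    then have "least (Sub S) ?J (Upper (Sub S) {A, B})"
      using AB by (auto simp: least_def Upper_def Sub_def)
    then show "\<exists>s. least (Sub S) s (Upper (Sub S) {A, B})" by blast
    have "subsemigrp (A \<inter> B) S" using AB by (auto simp: Sub_def subsemigrp_def)
    then have "greatest (Sub S) (A \<inter> B) (Lower (Sub S) {A, B})"
      using AB by (auto simp: greatest_def Lower_def Sub_def)
    then show "\<exists>s. greatest (Sub S) s (Lower (Sub S) {A, B})" by blast
  qed
qed

lemma lattice_iso_iff_join_meet:
  assumes "lattice L" "lattice M"
  shows "lattice_iso L M f \<longleftrightarrow> bij_betw f (carrier L) (carrier M) \<and>
    (\<forall>x\<in>carrier L. \<forall>y\<in>carrier L.
       f (x \<squnion>\<^bsub>L\<^esub> y) = f x \<squnion>\<^bsub>M\<^esub> f y \<and> f (x \<sqinter>\<^bsub>L\<^esub> y) = f x \<sqinter>\<^bsub>M\<^esub> f y)"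
    (is "_ \<longleftrightarrow> ?b \<and> ?h")
proof -
  interpret L: lattice L by fact
  interpret M: lattice M by fact
  show ?thesis
  proof
    assume "lattice_iso L M f"
    then have b: ?b
      and o: "\<And>x y. x \<in> carrier L \<Longrightarrow> y \<in> carrier L \<Longrightarrow> x \<sqsubseteq>\<^bsub>L\<^esub> y \<longleftrightarrow> f x \<sqsubseteq>\<^bsub>M\<^esub> f y"
      by (auto simp: lattice_iso_def)
    have c: "f x \<in> carrier M" if "x \<in> carrier L" for x using b that by (auto simp: bij_betw_def)
    have s: "\<exists>x\<in>carrier L. f x = y" if "y \<in> carrier M" for y
      using b that unfolding bij_betw_def by (metis imageE)
    have ?h
    proof (intro ballI conjI)
      fix x y assume xy: "x \<in> carrier L" "y \<in> carrier L"
      obtain u where u: "u \<in> carrier L" "f u = f x \<squnion>\<^bsub>M\<^esub> f y"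
        using s[of "f x \<squnion>\<^bsub>M\<^esub> f y"] xy c by auto
      have "x \<sqsubseteq>\<^bsub>L\<^esub> u" "y \<sqsubseteq>\<^bsub>L\<^esub> u"
        using o u xy c M.join_left M.join_right by auto
      then have "x \<squnion>\<^bsub>L\<^esub> y \<sqsubseteq>\<^bsub>L\<^esub> u"
        using u xy by (intro L.join_le)
      then have "f (x \<squnion>\<^bsub>L\<^esub> y) \<sqsubseteq>\<^bsub>M\<^esub> f u"
        using o u(1) xy by simp
      moreover have "f u \<sqsubseteq>\<^bsub>M\<^esub> f (x \<squnion>\<^bsub>L\<^esub> y)"
        unfolding u(2) using xy c o[symmetric] L.join_left L.join_right by (intro M.join_le) auto
      ultimately show "f (x \<squnion>\<^bsub>L\<^esub> y) = f x \<squnion>\<^bsub>M\<^esub> f y"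
        using u xy c M.le_antisym by auto
      obtain v where v: "v \<in> carrier L" "f v = f x \<sqinter>\<^bsub>M\<^esub> f y"
        using s[of "f x \<sqinter>\<^bsub>M\<^esub> f y"] xy c by auto
      have "v \<sqsubseteq>\<^bsub>L\<^esub> x" "v \<sqsubseteq>\<^bsub>L\<^esub> y"
        using o v xy c M.meet_left M.meet_right by auto
      then have "v \<sqsubseteq>\<^bsub>L\<^esub> x \<sqinter>\<^bsub>L\<^esub> y"
        using v xy by (intro L.meet_le)
      then have "f v \<sqsubseteq>\<^bsub>M\<^esub> f (x \<sqinter>\<^bsub>L\<^esub> y)"
        using o v(1) xy by simp
      moreover have "f (x \<sqinter>\<^bsub>L\<^esub> y) \<sqsubseteq>\<^bsub>M\<^esub> f v"
        unfolding v(2) using xy c o[symmetric] L.meet_left L.meet_right by (intro M.meet_le) auto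
      ultimately show "f (x \<sqinter>\<^bsub>L\<^esub> y) = f x \<sqinter>\<^bsub>M\<^esub> f y"
        using v xy c M.le_antisym by auto
    qed
    with b show "?b \<and> ?h" by blast
  next
    assume a: "?b \<and> ?h"
    have c: "f x \<in> carrier M" if "x \<in> carrier L" for x using a that by (auto simp: bij_betw_def)
    have "x \<sqsubseteq>\<^bsub>L\<^esub> y \<longleftrightarrow> f x \<sqsubseteq>\<^bsub>M\<^esub> f y" if xy: "x \<in> carrier L" "y \<in> carrier L" for x y
    proof -
      have "x \<sqsubseteq>\<^bsub>L\<^esub> y \<longleftrightarrow> x \<squnion>\<^bsub>L\<^esub> y = y"
        using L.le_iff_meet xy by simp
      also have "\<dots> \<longleftrightarrow> f (x \<squnion>\<^bsub>L\<^esub> y) = f y"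
        using a xy bij_betw_imp_inj_on[THEN inj_on_eq_iff] L.join_closed by metis
      also have "\<dots> \<longleftrightarrow> f x \<squnion>\<^bsub>M\<^esub> f y = f y"
        using a xy by simp
      also have "\<dots> \<longleftrightarrow> f x \<sqsubseteq>\<^bsub>M\<^esub> f y"
        using M.le_iff_meet xy c by simp
      finally show ?thesis .
    qed
    with a show "lattice_iso L M f" by (auto simp: lattice_iso_def)
  qed
qed

end

theory Submission
  imports Defs
begin

text \<open>In a torsion-free semigroup the atoms of the lattice of subsemigroups are the singletons of
  idempotents, and an infinite cyclic subsemigroup has a greatest proper subsemigroup. Hence a lattice
  isomorphism maps cyclic subsemigroups to cyclic ones and is induced by a bijection \<open>\<phi>\<close> of the
  elements that preserves and reflects subsemigroups; torsion-freeness and closedness of the set of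
  idempotents are inherited at once.

  For regularity let \<open>x\<close>, \<open>x'\<close> be mutually inverse, \<open>e = x x'\<close>, \<open>f = x' x\<close>, and let
  \<open>t, y, g, h\<close> be their images. If \<open>e\<close> and \<open>f\<close> generate incomparable ideals of the band of
  idempotents, then \<open>{x, x', e, f}\<close> is a \<open>\<J>\<close>-class of the subsemigroup generated by \<open>x\<close>
  and \<open>x'\<close>; comparing the subsemigroups that contain its complement forces
  \<open>{t y, y t} = {g, h}\<close>, and then \<open>t y t = t\<close>. Otherwise, after changing \<open>x'\<close> and possibly
  dualizing, \<open>e\<close> is a left unit of \<open>x\<close> and \<open>x'\<close>. If it is a two-sided unit, \<open>x\<close> and \<open>x'\<close>
  generate a bicyclic semigroup or a cyclic group, and \<open>e\<close> is reached only from products of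
  powers of \<open>x\<close> with powers of \<open>x'\<close>, which forces \<open>t y = g\<close> or \<open>y t = g\<close>. If it is not, this
  applies to \<open>x e\<close> in place of \<open>x\<close>.\<close>

section \<open>Semigroup operations on a type\<close>

definition mclosed :: "('a \<Rightarrow> 'a \<Rightarrow> 'a) \<Rightarrow> 'a set \<Rightarrow> bool" where
  "mclosed m A \<longleftrightarrow> (\<forall>a\<in>A. \<forall>b\<in>A. m a b \<in> A)"

inductive_set gen :: "('a \<Rightarrow> 'a \<Rightarrow> 'a) \<Rightarrow> 'a set \<Rightarrow> 'a set" for m A where
  gen_base: "a \<in> A \<Longrightarrow> a \<in> gen m A"
| gen_mult: "a \<in> gen m A \<Longrightarrow> b \<in> gen m A \<Longrightarrow> m a b \<in> gen m A"

text \<open>The exponent is shifted: \<open>pw m x n\<close> is $x^{n+1}$.\<close>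

primrec pw :: "('a \<Rightarrow> 'a \<Rightarrow> 'a) \<Rightarrow> 'a \<Rightarrow> nat \<Rightarrow> 'a" where
  "pw m x 0 = x"
| "pw m x (Suc n) = m (pw m x n) x"

definition cyc :: "('a \<Rightarrow> 'a \<Rightarrow> 'a) \<Rightarrow> 'a \<Rightarrow> 'a set" where
  "cyc m x = range (pw m x)"

text \<open>Left-right duals of results are obtained by instantiating them at
  \<open>opp m\<close>.\<close>

definition opp :: "('a \<Rightarrow> 'a \<Rightarrow> 'a) \<Rightarrow> 'a \<Rightarrow> 'a \<Rightarrow> 'a" where
  "opp m = (\<lambda>a b. m b a)"

lemma mclosedD: "mclosed m A \<Longrightarrow> a \<in> A \<Longrightarrow> b \<in> A \<Longrightarrow> m a b \<in> A"
  by (simp add: mclosed_def)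

lemma mclosed_gen: "mclosed m (gen m A)"
  by (simp add: mclosed_def gen_mult)

lemma gen_least: "mclosed m B \<Longrightarrow> A \<subseteq> B \<Longrightarrow> gen m A \<subseteq> B"
proof
  fix u assume "mclosed m B" "A \<subseteq> B" "u \<in> gen m A"
  from this(3) show "u \<in> B" by induction (use \<open>mclosed m B\<close> \<open>A \<subseteq> B\<close> in \<open>auto simp: mclosed_def\<close>)
qed

lemma gen_self: "A \<subseteq> gen m A"
  by (auto intro: gen_base)

lemma mclosed_opp [simp]: "mclosed (opp m) A = mclosed m A"
  by (auto simp: mclosed_def opp_def)

lemma opp_apply: "opp m a b = m b a"
  by (simp add: opp_def)

locale sgp =
  fixes m :: "'a \<Rightarrow> 'a \<Rightarrow> 'a"  (infixl "\<bullet>" 70)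
  assumes assoc: "(a \<bullet> b) \<bullet> c = a \<bullet> (b \<bullet> c)"
begin

lemma sgp_opp: "sgp (opp m)"
  by unfold_locales (simp add: opp_def assoc)

lemma lrew: "a \<bullet> b = c \<Longrightarrow> a \<bullet> (b \<bullet> z) = c \<bullet> z"
  using assoc by metis

lemma pw_add: "pw m x a \<bullet> pw m x b = pw m x (Suc (a + b))"
  by (induction b) (simp_all flip: assoc)

lemma pw_Suc_left: "pw m x (Suc n) = x \<bullet> pw m x n"
  using pw_add[of x 0 n] by simp

lemma pw_opp [simp]: "pw (opp m) = pw m"
proof (intro ext)
  fix x k
  show "pw (opp m) x k = pw m x k"
  proof (induction k)
    case (Suc k)
    then show ?case using pw_Suc_left[of x k] by (simp add: opp_def)
  qed simp
qed

lemma cyc_opp [simp]: "cyc (opp m) x = cyc m x"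
  by (simp add: cyc_def)

text \<open>Unshifted, exponents multiply: (a + 1)(b + 1) = (a + b + a b) + 1.\<close>

lemma pw_pw: "pw m (pw m x a) b = pw m x (a + b + a * b)"
proof (induction b)
  case (Suc b)
  then show ?case by (simp add: pw_add algebra_simps)
qed simp

lemma cyc_self: "x \<in> cyc m x"
  unfolding cyc_def by (metis pw.simps(1) rangeI)

lemma mclosed_cyc: "mclosed m (cyc m x)"
  by (auto simp: mclosed_def cyc_def pw_add simp del: pw.simps)

lemma cyc_least: "mclosed m B \<Longrightarrow> x \<in> B \<Longrightarrow> cyc m x \<subseteq> B"
proof -
  assume "mclosed m B" "x \<in> B"
  then have "pw m x n \<in> B" for n by (induction n) (auto simp: mclosed_def)
  then show ?thesis by (auto simp: cyc_def)
qed

lemma cyc_gen: "cyc m x = gen m {x}"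
  by (intro subset_antisym cyc_least gen_least)
     (auto simp: mclosed_gen mclosed_cyc cyc_self gen_base)

lemma idem_cyc: "e \<bullet> e = e \<Longrightarrow> cyc m e = {e}"
  using cyc_least[of "{e}" e] cyc_self[of e] by (auto simp: mclosed_def)

lemma idem_in_cyc:
  assumes "\<not> inj (pw m z)"
  obtains e where "e \<in> cyc m z" "e \<bullet> e = e"
proof -
  from assms obtain i j where "i < j" "pw m z i = pw m z j"
    unfolding inj_def by (metis nat_neq_iff)
  then obtain d where "pw m z i = pw m z (i + Suc d)" by (auto simp: less_iff_Suc_add)
  then have step: "pw m z (i + k) = pw m z (i + k + Suc d)" for k
    by (induction k) simp_all
  have per: "pw m z (i + k) = pw m z (i + k + n * Suc d)" for k n
  proof (induction n)
    case (Suc n)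
    then show ?case using step[of "k + n * Suc d"] by (simp add: algebra_simps)
  qed simp
  \<comment> \<open>The true exponent i + k + 1 = (i + 1)(d + 1) is a multiple of the period d + 1,
    so squaring does not change this power.\<close>
  define k where "k = i * d + d"
  have "pw m z (i + k) = pw m z (i + k + Suc i * Suc d)" by (rule per)
  also have "i + k + Suc i * Suc d = Suc ((i + k) + (i + k))" by (simp add: k_def algebra_simps)
  finally have "pw m z (Suc ((i + k) + (i + k))) = pw m z (i + k)" by (rule sym)
  then have "pw m z (i + k) \<bullet> pw m z (i + k) = pw m z (i + k)" by (rule trans[OF pw_add])
  then show thesis using that unfolding cyc_def by blast
qed

lemma inj_pw_not_idem: "inj (pw m z) \<Longrightarrow> e \<in> cyc m z \<Longrightarrow> e \<bullet> e \<noteq> e"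
proof -
  assume "inj (pw m z)" "e \<in> cyc m z"
  then obtain n where n: "e = pw m z n" by (auto simp: cyc_def)
  have "pw m z (Suc (n + n)) \<noteq> pw m z n"
    using injD[OF \<open>inj (pw m z)\<close>, of "Suc (n + n)" n] by auto
  then show ?thesis using pw_add[of z n n] n by simp
qed

text \<open>If a = z^(i+1) and b = z^(j+1), then a^(j+1) = b^(i+1), and an idempotent equals its own
  powers.\<close>

lemma idem_cyc_unique:
  assumes "a \<in> cyc m z" "b \<in> cyc m z" "a \<bullet> a = a" "b \<bullet> b = b"
  shows "a = b"
proof -
  obtain i j where ij: "a = pw m z i" "b = pw m z j" using assms(1,2) by (auto simp: cyc_def)
  have "pw m a j = pw m b i" by (simp only: ij pw_pw add.commute mult.commute)
  moreover have "pw m a j = a" "pw m b i = b"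
    using assms(3,4) idem_cyc by (auto simp: cyc_def)
  ultimately show ?thesis by simp
qed

lemma finite_order_pw:
  assumes "\<not> inj (pw m z)"
  shows "\<not> inj (pw m (pw m z k))"
  using assms
proof -
  obtain i j where "i \<noteq> j" "pw m z i = pw m z j" using assms by (auto simp: inj_def)
  moreover have "pw m (pw m z k) l = pw m (pw m z l) k" for l
    by (simp only: pw_pw add.commute mult.commute)
  ultimately have "pw m (pw m z k) i = pw m (pw m z k) j" by simp
  then show ?thesis using \<open>i \<noteq> j\<close> by (auto simp: inj_def)
qed

text \<open>Each generator is a power of the other, so y = y^((a+1)(b+1)), and distinctness of the
  powers of \<open>y\<close> makes both exponents 1.\<close>

lemma cyc_eq_imp_eq:
  assumes "inj (pw m y)" "cyc m y = cyc m z"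
  shows "y = z"
proof -
  obtain a b where a: "y = pw m z a" and b: "z = pw m y b"
    using assms(2) cyc_self unfolding cyc_def by blast
  then have "pw m y 0 = pw m y (b + a + b * a)" using pw_pw[of y b a] by simp
  then have "0 = b + a + b * a" by (rule injD[OF assms(1)])
  then have "b = 0" by simp
  then show ?thesis using b by simp
qed

end

section \<open>Bijections preserving closed subsets\<close>

context sgp
begin

text \<open>If g t = t^(k+1), then \<open>g\<close> fixes t^(k+1). For k > 0 it also sends it to (g
  t) t^k = t^(2k+1), against injectivity; so k = 0.\<close>

lemma left_unit_of_cyc:
  assumes "inj (pw m t)" "g \<bullet> g = g" "g \<bullet> t \<in> cyc m t"
  shows "g \<bullet> t = t"
proof -
  obtain k where k: "g \<bullet> t = pw m t k" using assms(3) by (auto simp: cyc_def)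
  show ?thesis
  proof (cases k)
    case (Suc l)
    have "pw m t k = g \<bullet> pw m t k" using k assms(2) lrew by metis
    also have "\<dots> = (g \<bullet> t) \<bullet> pw m t l" by (simp only: Suc pw_Suc_left assoc)
    also have "\<dots> = pw m t (Suc (k + l))" unfolding k by (rule pw_add)
    finally have "k = Suc (k + l)" by (rule injD[OF assms(1)])
    then show ?thesis using Suc by simp
  qed (use k in simp)
qed

lemma right_unit_of_cyc:
  assumes "inj (pw m t)" "g \<bullet> g = g" "t \<bullet> g \<in> cyc m t"
  shows "t \<bullet> g = t"
  using sgp.left_unit_of_cyc[OF sgp_opp, of t g] assms
  by (simp add: opp_apply)

text \<open>The mixed cases would make \<open>t\<close> idempotent: for instance, g t = t and t g =
  g give t t = t g t = g t = t.\<close>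

lemma unit_or_zero:
  assumes t: "inj (pw m t)" and g: "g \<bullet> g = g" and cl: "mclosed m ({g} \<union> cyc m t)"
  shows "g \<bullet> t = t \<and> t \<bullet> g = t \<or> g \<bullet> t = g \<and> t \<bullet> g = g"
proof -
  have l: "g \<bullet> t = g \<or> g \<bullet> t = t"
    using left_unit_of_cyc[OF t g] cl cyc_self[of t] by (auto simp: mclosed_def)
  have r: "t \<bullet> g = g \<or> t \<bullet> g = t"
    using right_unit_of_cyc[OF t g] cl cyc_self[of t] by (auto simp: mclosed_def)
  have tt: "t \<bullet> t \<noteq> t" using inj_pw_not_idem[OF t cyc_self] .
  then show ?thesis using l r g assoc by metis
qed

text \<open>If t y lies in \<open>cyc m y\<close>, that set absorbs \<open>t\<close> from the left.
  Otherwise all t^i y lie in \<open>I \<union> cyc m t\<close>, and induction on the exponent of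
  \<open>y\<close> applies. This serves to show that the union of all three sets is closed.\<close>

lemma cyc_mult_cyc:
  assumes It: "mclosed m (I \<union> cyc m t)" and Iy: "mclosed m (I \<union> cyc m y)"
    and ty: "t \<bullet> y \<in> I \<union> cyc m t \<union> cyc m y" and ab: "a \<in> cyc m t" "b \<in> cyc m y"
  shows "a \<bullet> b \<in> I \<union> cyc m t \<union> cyc m y"
proof -
  have pt: "pw m t i \<in> cyc m t" and py: "pw m y i \<in> cyc m y" for i by (auto simp: cyc_def)
  have "pw m t i \<bullet> pw m y j \<in> I \<union> cyc m t \<union> cyc m y" for i j
  proof (cases "t \<bullet> y \<in> cyc m y")
    case True
    have 1: "t \<bullet> pw m y j \<in> cyc m y" for j
    proof (induction j)
      case (Suc j)
      then show ?case using mclosedD[OF mclosed_cyc _ cyc_self] by (simp flip: assoc)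
    qed (use True in simp)
    have "t \<bullet> v \<in> cyc m y" if "v \<in> cyc m y" for v using 1 that by (auto simp: cyc_def)
    then have "pw m t i \<bullet> v \<in> cyc m y" if "v \<in> cyc m y" for v
      using that by (induction i arbitrary: v) (simp_all add: assoc)
    then show ?thesis using py by blast
  next
    case False
    then have "t \<bullet> y \<in> I \<union> cyc m t" using ty by blast
    then have 1: "pw m t i \<bullet> y \<in> I \<union> cyc m t" for i
    proof (cases i)
      case (Suc l)
      have "pw m t l \<bullet> (t \<bullet> y) \<in> I \<union> cyc m t"
        using mclosedD[OF It] pt \<open>t \<bullet> y \<in> I \<union> cyc m t\<close> by blast
      then show ?thesis by (simp add: Suc assoc)
    qed simp
    show ?thesis
    proof (induction j arbitrary: i)
      case 0
      then show ?case using 1 by auto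
    next
      case (Suc j)
      have "pw m t i \<bullet> pw m y (Suc j) = (pw m t i \<bullet> y) \<bullet> pw m y j"
        by (simp only: pw_Suc_left assoc)
      moreover have "(pw m t i \<bullet> y) \<bullet> pw m y j \<in> I \<union> cyc m t \<union> cyc m y"
      proof (cases "pw m t i \<bullet> y \<in> cyc m t")
        case True
        then obtain k where "pw m t i \<bullet> y = pw m t k" by (auto simp: cyc_def)
        then show ?thesis using Suc.IH[of k] by simp
      next
        case False
        then have "pw m t i \<bullet> y \<in> I" using 1 by blast
        then show ?thesis using mclosedD[OF Iy] py by blast
      qed
      ultimately show ?case by simp
    qed
  qed
  then show ?thesis using ab by (auto simp: cyc_def)
qed

end

text \<open>Element form of a lattice isomorphism: \<open>\<phi>\<close> need not respect products;
  only closedness of subsets of \<open>C\<close> is transferred, in both directions.\<close>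

locale sbij = S: sgp m + T: sgp n
  for m :: "'a \<Rightarrow> 'a \<Rightarrow> 'a"  (infixl "\<bullet>" 70)
  and n :: "'b \<Rightarrow> 'b \<Rightarrow> 'b"  (infixl "\<star>" 70) +
  fixes \<phi> :: "'a \<Rightarrow> 'b" and C :: "'a set"
  assumes inj: "inj_on \<phi> C"
    and C_closed: "mclosed m C"
    and sub_iff: "A \<subseteq> C \<Longrightarrow> mclosed n (\<phi> ` A) \<longleftrightarrow> mclosed m A"
    and S_tf: "x \<in> C \<Longrightarrow> x \<bullet> x \<noteq> x \<Longrightarrow> inj (pw m x)"
    and T_tf: "x \<in> C \<Longrightarrow> x \<bullet> x \<noteq> x \<Longrightarrow> inj (pw n (\<phi> x))"
begin

text \<open>Closedness of a set ignores the order of factors, so one operation may be reversed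
  without the other. Reversing only the target exchanges the two products of a pair of
  images.\<close>

lemma sbij_opp_left: "sbij (opp m) n \<phi> C"
  by (intro sbij.intro sbij_axioms.intro S.sgp_opp T.sgp_axioms inj; (unfold opp_apply mclosed_opp S.pw_opp)?)
     (fact C_closed sub_iff S_tf T_tf)+

lemma sbij_opp_right: "sbij m (opp n) \<phi> C"
  by (intro sbij.intro sbij_axioms.intro T.sgp_opp S.sgp_axioms inj; (unfold opp_apply mclosed_opp T.pw_opp)?)
     (fact C_closed sub_iff S_tf T_tf)+

lemma mult_C: "x \<in> C \<Longrightarrow> y \<in> C \<Longrightarrow> x \<bullet> y \<in> C"
  using C_closed by (rule mclosedD)

lemma gen_C: "A \<subseteq> C \<Longrightarrow> gen m A \<subseteq> C"
  using C_closed by (rule gen_least)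

lemma cyc_C: "x \<in> C \<Longrightarrow> cyc m x \<subseteq> C"
  using C_closed by (rule S.cyc_least)

text \<open>The set generated by the image of \<open>A\<close> is the image of some
  \<open>B\<close>; by \<open>sub_iff\<close> this \<open>B\<close> is closed, and it contains
  \<open>A\<close>, hence \<open>gen m A\<close>.\<close>

lemma image_gen:
  assumes "A \<subseteq> C"
  shows "\<phi> ` gen m A = gen n (\<phi> ` A)"
proof (rule subset_antisym)
  show "gen n (\<phi> ` A) \<subseteq> \<phi> ` gen m A"
    using sub_iff[OF gen_C[OF assms]] by (intro gen_least image_mono gen_self) (simp add: mclosed_gen)
  then have "gen n (\<phi> ` A) \<subseteq> \<phi> ` C" using gen_C[OF assms] by blast
  then obtain B where B: "B \<subseteq> C" "gen n (\<phi> ` A) = \<phi> ` B" by (metis subset_imageE)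
  then have "mclosed m B" using sub_iff[of B] mclosed_gen[of n "\<phi> ` A"] by simp
  moreover have "A \<subseteq> B"
    using B gen_self[of "\<phi> ` A" n] inj_on_image_mem_iff[OF inj _ B(1)] assms by blast
  ultimately show "\<phi> ` gen m A \<subseteq> gen n (\<phi> ` A)" using B(2) gen_least[of m B A] by auto
qed

lemma image_cyc: "x \<in> C \<Longrightarrow> \<phi> ` cyc m x = cyc n (\<phi> x)"
  using image_gen[of "{x}"] by (simp add: S.cyc_gen T.cyc_gen)

lemma image_in_iff: "x \<in> C \<Longrightarrow> A \<subseteq> C \<Longrightarrow> \<phi> x \<in> \<phi> ` A \<longleftrightarrow> x \<in> A"
  using inj by (simp add: inj_on_image_mem_iff)

lemma image_eq_iff: "x \<in> C \<Longrightarrow> y \<in> C \<Longrightarrow> \<phi> x = \<phi> y \<longleftrightarrow> x = y"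
  using inj by (auto simp: inj_on_def)

lemma idem_iff: "x \<in> C \<Longrightarrow> \<phi> x \<star> \<phi> x = \<phi> x \<longleftrightarrow> x \<bullet> x = x"
  using sub_iff[of "{x}"] by (simp add: mclosed_def)

lemma mult_image:
  assumes "A \<subseteq> C" "mclosed m A" "a \<in> \<phi> ` A" "b \<in> \<phi> ` A"
  shows "a \<star> b \<in> \<phi> ` A"
  using assms sub_iff[OF assms(1)] mclosedD[of n "\<phi> ` A"] by simp

text \<open>The image of \<open>e\<close> acts on that of \<open>x\<close> as a unit or as a zero; a zero is excluded
  because \<open>x\<close> is generated by \<open>x\<^sup>2\<close> and \<open>x'\<close>.\<close>

lemma unit_case_aux:
  assumes C: "x \<in> C" "x' \<in> C" "e \<in> C" "I \<subseteq> C"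
    and cl: "mclosed m I" "mclosed m (I \<union> cyc m x)" "mclosed m (I \<union> cyc m x')"
    and e: "e \<bullet> e = e" "e \<bullet> x = x" "x \<bullet> e = x" "e \<bullet> x' = x'" "x' \<bullet> e = x'"
    and eI: "e \<notin> I" and idem: "x \<bullet> x \<noteq> x" "x' \<bullet> x' \<noteq> x'"
    and gen: "gen m {x, x'} = I \<union> cyc m x \<union> cyc m x' \<union> {e}"
    and x: "x \<in> gen m {x \<bullet> x, x'}"
    and ty: "\<phi> x \<star> \<phi> x' = \<phi> e"
  shows "\<phi> e \<star> \<phi> x = \<phi> x \<and> \<phi> x \<star> \<phi> e = \<phi> x \<and> \<phi> e \<star> \<phi> x' = \<phi> x' \<and> \<phi> x' \<star> \<phi> e = \<phi> x'"
proof -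
  define t y g where "t = \<phi> x" and "y = \<phi> x'" and "g = \<phi> e"
  note defs = t_def y_def g_def
  have ty: "t \<star> y = g" using ty by (simp add: defs)
  have gg: "g \<star> g = g" using idem_iff C e(1) by (simp add: defs)
  have tinj: "inj (pw n t)" and yinj: "inj (pw n y)" using T_tf C idem by (auto simp: defs)
  have clx: "mclosed m ({e} \<union> cyc m z)" if "e \<bullet> z = z" "z \<bullet> e = z" for z
  proof -
    have "e \<bullet> pw m z k = pw m z k" "pw m z k \<bullet> e = pw m z k" for k
      using that by (induction k) (simp_all add: S.assoc flip: S.assoc[of e])
    then show ?thesis using S.mclosed_cyc[of z] e(1) by (auto simp: mclosed_def cyc_def)
  qed
  have gt: "g \<star> t = t \<and> t \<star> g = t \<or> g \<star> t = g \<and> t \<star> g = g"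
  proof (rule T.unit_or_zero[OF tinj gg])
    show "mclosed n ({g} \<union> cyc n t)"
      using sub_iff[of "{e} \<union> cyc m x"] clx[of x] e C cyc_C image_cyc[of x]
      by (simp add: defs image_Un)
  qed
  have gy: "g \<star> y = y \<and> y \<star> g = y \<or> g \<star> y = g \<and> y \<star> g = g"
  proof (rule T.unit_or_zero[OF yinj gg])
    show "mclosed n ({g} \<union> cyc n y)"
      using sub_iff[of "{e} \<union> cyc m x'"] clx[of x'] e C cyc_C image_cyc[of x']
      by (simp add: defs image_Un)
  qed
  have gnt: "g \<notin> cyc n t" "g \<notin> cyc n y"
    using T.inj_pw_not_idem[OF tinj] T.inj_pw_not_idem[OF yinj] gg by blast+
  have "g \<star> t = t"
  proof (rule ccontr)
    assume "g \<star> t \<noteq> t"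
    \<comment> \<open>\<open>g\<close> is now a zero for \<open>t\<close> and, because t y = g, also
      for \<open>y\<close>. Each of the four possible places of y t then leads to a
      contradiction.\<close>
    then have g0: "g \<star> t = g" "t \<star> g = g" using gt by auto
    then have "g \<star> y = g" using ty gg T.assoc by metis
    then have g1: "g \<star> y = g" "y \<star> g = g" using gy gg gnt T.cyc_self by metis+
    have V: "y \<star> t \<in> \<phi> ` gen m {x, x'}"
      using C gen_C mclosed_gen gen_self[of "{x, x'}" m]
      by (intro mult_image) (auto simp: defs)
    then consider "y \<star> t \<in> \<phi> ` I" | "y \<star> t \<in> cyc n t" | "y \<star> t \<in> cyc n y" | "y \<star> t = g"
      using image_cyc C by (auto simp: gen image_Un defs)
    then show False
    proof cases
      case 1
      then have "(y \<star> t) \<star> (y \<star> t) \<in> \<phi> ` I" using mult_image[OF C(4) cl(1)] by blast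
      moreover have "(y \<star> t) \<star> (y \<star> t) = g" using ty g0 g1 T.assoc by metis
      ultimately show False using eI image_in_iff[OF C(3,4)] by (simp add: defs)
    next
      case 2
      then have "t \<star> (y \<star> t) \<in> cyc n t" using mclosedD[OF T.mclosed_cyc T.cyc_self] by blast
      then show False using ty g0 gnt T.assoc by metis
    next
      case 3
      then have "(y \<star> t) \<star> y \<in> cyc n y" using mclosedD[OF T.mclosed_cyc _ T.cyc_self] by blast
      then show False using ty g1 gnt T.assoc by metis
    next
      case 4
      \<comment> \<open>All mixed products of powers of \<open>t\<close> and \<open>y\<close> equal
        \<open>g\<close>, so \<open>D\<close> is closed. It contains the images of x^2 and x' and
        hence \<open>t\<close>, which generation by them yields; yet \<open>t\<close> lies in none
        of its three pieces.\<close>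
      define D where "D = cyc n (\<phi> (x \<bullet> x)) \<union> cyc n y \<union> {g}"
      have xx: "x \<bullet> x \<in> C" using mult_C C by blast
      have "x \<bullet> x \<in> cyc m x" using S.cyc_self mclosedD S.mclosed_cyc by metis
      then have "\<phi> (x \<bullet> x) \<in> cyc n t" using image_cyc C by (auto simp: defs)
      then have ts: "cyc n (\<phi> (x \<bullet> x)) \<subseteq> cyc n t" using T.cyc_least T.mclosed_cyc by metis
      have z: "g \<star> pw n t k = g" "pw n t k \<star> g = g" "g \<star> pw n y k = g" "pw n y k \<star> g = g" for k
        using g0 g1 by (induction k) (simp_all add: T.assoc flip: T.assoc[of g])
      have "pw n t i \<star> pw n y j = g" for i j
      proof (induction j arbitrary: i)
        case 0
        then show ?case using ty z g0
          by (cases i) (simp_all add: T.assoc)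
      next
        case (Suc j)
        then show ?case using g1 by (simp flip: T.assoc)
      qed
      moreover have "pw n y i \<star> pw n t j = g" for i j
      proof (induction j arbitrary: i)
        case 0
        then show ?case using 4 z g1
          by (cases i) (simp_all add: T.assoc)
      next
        case (Suc j)
        then show ?case using g0 by (simp flip: T.assoc)
      qed
      ultimately have prods: "a \<star> b = g \<and> b \<star> a = g" if "a \<in> cyc n t" "b \<in> cyc n y" for a b
        using that by (auto simp: cyc_def)
      have zc: "a \<star> g = g \<and> g \<star> a = g" if "a \<in> cyc n t \<union> cyc n y" for a
        using that z by (auto simp: cyc_def)
      have "mclosed n D"
        unfolding mclosed_def D_def
        using mclosedD[OF T.mclosed_cyc] prods zc ts gg by blast
      moreover have "{\<phi> (x \<bullet> x), y} \<subseteq> D" using T.cyc_self by (auto simp: D_def)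
      ultimately have "gen n {\<phi> (x \<bullet> x), y} \<subseteq> D" by (rule gen_least)
      moreover have "t \<in> gen n {\<phi> (x \<bullet> x), y}"
        using image_gen[of "{x \<bullet> x, x'}"] x xx C by (auto simp: defs)
      ultimately have "t \<in> D" by blast
      moreover have "t \<noteq> g" using gnt T.cyc_self by metis
      moreover have "t \<notin> cyc n y"
      proof
        assume "t \<in> cyc n y"
        then have "t \<star> y \<in> cyc n y" using mclosedD[OF T.mclosed_cyc _ T.cyc_self] by blast
        then show False using ty gnt by simp
      qed
      moreover have "t \<notin> cyc n (\<phi> (x \<bullet> x))"
      proof
        assume "t \<in> cyc n (\<phi> (x \<bullet> x))"
        then have "x \<in> cyc m (x \<bullet> x)"
          using image_cyc[OF xx] image_in_iff[OF C(1) cyc_C[OF xx]] by (simp add: defs)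
        then obtain k where "pw m x 0 = pw m (pw m x 1) k" by (auto simp: cyc_def)
        then have "pw m x 0 = pw m x (1 + k + 1 * k)" by (simp only: S.pw_pw)
        then have "0 = 1 + k + 1 * k" by (rule injD[OF S_tf[OF C(1) idem(1)]])
        then show False by simp
      qed
      ultimately show False by (auto simp: D_def)
    qed
  qed
  moreover from this have tg: "t \<star> g = t" using gt gnt T.cyc_self by metis
  moreover have "g \<star> y = y"
  proof (rule ccontr)
    assume "g \<star> y \<noteq> y"
    then have "y \<star> g = g" using gy by auto
    then have "g = t" using ty tg T.assoc gg by metis
    then show False using gnt T.cyc_self by metis
  qed
  moreover from this have "y \<star> g = y" using gy gnt T.cyc_self by metis
  ultimately show ?thesis by (simp add: defs)
qed

text \<open>If neither product of the images were the image of \<open>e\<close>,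
  \<open>cyc_mult_cyc\<close> would make \<open>I \<union> cyc m x \<union> cyc m x'\<close> closed,
  although x and x' generate \<open>e\<close>, which lies outside it. Then
  \<open>unit_case_aux\<close> applies, to the reversed target operation in the second case.\<close>

lemma unit_case:
  assumes C: "x \<in> C" "x' \<in> C" "e \<in> C" "I \<subseteq> C"
    and cl: "mclosed m I" "mclosed m (I \<union> cyc m x)" "mclosed m (I \<union> cyc m x')"
    and e: "e \<bullet> e = e" "e \<bullet> x = x" "x \<bullet> e = x" "e \<bullet> x' = x'" "x' \<bullet> e = x'"
    and eI: "e \<notin> I" and idem: "x \<bullet> x \<noteq> x" "x' \<bullet> x' \<noteq> x'"
    and gen: "gen m {x, x'} = I \<union> cyc m x \<union> cyc m x' \<union> {e}"
    and x: "x \<in> gen m {x \<bullet> x, x'}"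
  shows "(\<phi> x \<star> \<phi> x' = \<phi> e \<or> \<phi> x' \<star> \<phi> x = \<phi> e) \<and>
    \<phi> e \<star> \<phi> x = \<phi> x \<and> \<phi> x \<star> \<phi> e = \<phi> x \<and> \<phi> e \<star> \<phi> x' = \<phi> x' \<and> \<phi> x' \<star> \<phi> e = \<phi> x'"
proof -
  let ?D = "\<phi> ` I \<union> cyc n (\<phi> x) \<union> cyc n (\<phi> x')"
  have DI: "\<phi> ` (I \<union> cyc m x \<union> cyc m x') = ?D" using image_cyc C by (simp add: image_Un)
  have IC: "I \<union> cyc m x \<union> cyc m x' \<subseteq> C" using C cyc_C by auto
  have It: "mclosed n (\<phi> ` I \<union> cyc n (\<phi> x))"
    using sub_iff[of "I \<union> cyc m x"] cl(2) C cyc_C image_cyc by (simp add: image_Un)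
  have Iy: "mclosed n (\<phi> ` I \<union> cyc n (\<phi> x'))"
    using sub_iff[of "I \<union> cyc m x'"] cl(3) C cyc_C image_cyc by (simp add: image_Un)
  have V: "a \<star> b \<in> ?D \<union> {\<phi> e}" if "a \<in> {\<phi> x, \<phi> x'}" "b \<in> {\<phi> x, \<phi> x'}" for a b
  proof -
    have "a \<star> b \<in> \<phi> ` gen m {x, x'}"
      using C that gen_self[of "{x, x'}" m] by (intro mult_image gen_C mclosed_gen) auto
    then show ?thesis using DI by (simp add: gen)
  qed
  have "\<phi> x \<star> \<phi> x' = \<phi> e \<or> \<phi> x' \<star> \<phi> x = \<phi> e"
  proof (rule ccontr)
    assume "\<not> ?thesis"
    then have "\<phi> x \<star> \<phi> x' \<in> ?D" "\<phi> x' \<star> \<phi> x \<in> \<phi> ` I \<union> cyc n (\<phi> x') \<union> cyc n (\<phi> x)"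
      using V[of "\<phi> x" "\<phi> x'"] V[of "\<phi> x'" "\<phi> x"] by auto
    then have p: "a \<star> b \<in> ?D \<and> b \<star> a \<in> ?D" if "a \<in> cyc n (\<phi> x)" "b \<in> cyc n (\<phi> x')" for a b
      using that T.cyc_mult_cyc[OF It Iy] T.cyc_mult_cyc[OF Iy It] by blast
    have "mclosed n ?D"
      unfolding mclosed_def using p mclosedD[OF It] mclosedD[OF Iy] by blast
    then have "mclosed m (I \<union> cyc m x \<union> cyc m x')" using DI sub_iff[OF IC] by metis
    then have "gen m {x, x'} \<subseteq> I \<union> cyc m x \<union> cyc m x'"
      using S.cyc_self by (intro gen_least) auto
    then have "e \<in> I \<union> cyc m x \<union> cyc m x'" using gen by auto
    then show False
      using eI S.inj_pw_not_idem[OF S_tf[OF C(1) idem(1)]] S.inj_pw_not_idem[OF S_tf[OF C(2) idem(2)]] e(1)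
      by blast
  qed
  moreover have "\<phi> x \<star> \<phi> x' = \<phi> e \<Longrightarrow> ?thesis"
    using unit_case_aux[OF assms] by auto
  moreover have "\<phi> x' \<star> \<phi> x = \<phi> e \<Longrightarrow> ?thesis"
    using sbij.unit_case_aux[OF sbij_opp_right assms] by (auto simp: opp_apply)
  ultimately show ?thesis by blast
qed

end

section \<open>Elements with a two-sided unit\<close>

text \<open>Powers in a monoid with identity \<open>e\<close>; unlike in \<open>pw\<close>, the
  exponent is not shifted.\<close>

primrec upw :: "('a \<Rightarrow> 'a \<Rightarrow> 'a) \<Rightarrow> 'a \<Rightarrow> 'a \<Rightarrow> nat \<Rightarrow> 'a" where
  "upw m e x 0 = e"
| "upw m e x (Suc n) = m (upw m e x n) x"

context sgp
begin

lemma upw_unit: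
  assumes "e \<bullet> e = e" "e \<bullet> x = x" "x \<bullet> e = x"
  shows "e \<bullet> upw m e x k = upw m e x k" "upw m e x k \<bullet> e = upw m e x k"
  using assms by (induction k) (simp_all add: assoc flip: assoc[of e])

lemma upw_add:
  assumes "e \<bullet> e = e" "e \<bullet> x = x" "x \<bullet> e = x"
  shows "upw m e x a \<bullet> upw m e x b = upw m e x (a + b)"
  by (induction b) (simp_all add: upw_unit[OF assms] flip: assoc)

lemma upw_Suc_left:
  assumes "e \<bullet> e = e" "e \<bullet> x = x" "x \<bullet> e = x"
  shows "upw m e x (Suc k) = x \<bullet> upw m e x k"
  using upw_add[OF assms, of 1 k] assms(2) by simp

lemma upw_Suc_pw:
  assumes "e \<bullet> x = x"
  shows "upw m e x (Suc k) = pw m x k"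
  using assms by (induction k) simp_all

lemma cyc_upw:
  assumes "e \<bullet> x = x"
  shows "cyc m x = {upw m e x (Suc k) |k. True}"
  unfolding upw_Suc_pw[OF assms] by (auto simp: cyc_def)

text \<open>Factors x y = e cancel in the middle, as in the bicyclic monoid. Subtraction is
  truncated, so at most one exponent on the right is positive.\<close>

lemma upw_cancel:
  assumes "e \<bullet> e = e" "e \<bullet> x = x" "x \<bullet> e = x" "e \<bullet> y = y" "y \<bullet> e = y" "x \<bullet> y = e"
  shows "upw m e x j \<bullet> upw m e y k = upw m e y (k - j) \<bullet> upw m e x (j - k)"
proof (induction j k rule: diff_induct)
  case (3 j k)
  have "upw m e x (Suc j) \<bullet> upw m e y (Suc k) = upw m e x j \<bullet> ((x \<bullet> y) \<bullet> upw m e y k)"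
    using upw_Suc_left[OF assms(1,4,5)] by (simp add: assoc)
  also have "\<dots> = upw m e x j \<bullet> upw m e y k" using assms upw_unit by simp
  finally show ?case using 3 by simp
qed (simp_all add: upw_unit assms del: upw.simps(2))

end

context sbij
begin

text \<open>The products x'^i x^j form a bicyclic monoid, or a cyclic group if also x' x = e.
  \<open>unit_case\<close> applies with \<open>I\<close> empty for the group, and otherwise with
  \<open>I\<close> the products having both exponents positive.\<close>

lemma unit_pair:
  assumes C: "x \<in> C" "x' \<in> C" and idem: "x \<bullet> x \<noteq> x" "x' \<bullet> x' \<noteq> x'"
    and e: "e \<bullet> e = e" "e \<bullet> x = x" "x \<bullet> e = x" "e \<bullet> x' = x'" "x' \<bullet> e = x'" "x \<bullet> x' = e"
  shows "(\<phi> x \<star> \<phi> x' = \<phi> e \<or> \<phi> x' \<star> \<phi> x = \<phi> e) \<and>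
    \<phi> e \<star> \<phi> x = \<phi> x \<and> \<phi> x \<star> \<phi> e = \<phi> x \<and> \<phi> e \<star> \<phi> x' = \<phi> x' \<and> \<phi> x' \<star> \<phi> e = \<phi> x'"
proof -
  define P where "P i j = upw m e x' i \<bullet> upw m e x j" for i j
  have P_mult: "P i j \<bullet> P k l = P (i + (k - j)) (j - k + l)" for i j k l
  proof -
    have "P i j \<bullet> P k l = upw m e x' i \<bullet> ((upw m e x j \<bullet> upw m e x' k) \<bullet> upw m e x l)"
      by (simp add: P_def S.assoc)
    also have "\<dots> = (upw m e x' i \<bullet> upw m e x' (k - j)) \<bullet> (upw m e x (j - k) \<bullet> upw m e x l)"
      by (simp add: S.upw_cancel[OF e] S.assoc)
    finally show ?thesis using e by (simp add: P_def S.upw_add)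
  qed
  have P0: "P 0 j = upw m e x j" "P j 0 = upw m e x' j" for j
    using e by (simp_all add: P_def S.upw_unit)
  have cx: "cyc m x = {P 0 (Suc j) |j. True}" and cx': "cyc m x' = {P (Suc i) 0 |i. True}"
    unfolding P0 by (rule S.cyc_upw, fact e)+
  have e0: "e = P 0 0" using P0(1)[of 0] by simp
  have eC: "e \<in> C" using mult_C C e(6) by metis
  have gen: "gen m {x, x'} = {P i j |i j. True}"
  proof (rule subset_antisym)
    have "x = P 0 1" "x' = P 1 0" using e by (simp_all add: P0)
    moreover have "mclosed m {P i j |i j. True}"
      unfolding mclosed_def using P_mult by blast
    ultimately show "gen m {x, x'} \<subseteq> {P i j |i j. True}"
      by (intro gen_least) auto
    have "e \<in> gen m {x, x'}" using gen_mult[of x m "{x, x'}" x'] e(6) by (simp add: gen_base)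
    then have "upw m e x j \<in> gen m {x, x'}" "upw m e x' j \<in> gen m {x, x'}" for j
      by (induction j) (auto intro: gen_mult gen_base)
    then show "{P i j |i j. True} \<subseteq> gen m {x, x'}" by (auto simp: P_def intro: gen_mult)
  qed
  have xgen: "x \<in> gen m {x \<bullet> x, x'}"
  proof -
    have "(x \<bullet> x) \<bullet> x' = x" using e by (simp add: S.assoc)
    then show ?thesis by (metis gen_mult gen_base insertCI)
  qed
  show ?thesis
  proof (cases "x' \<bullet> x = e")
    case True
    \<comment> \<open>Now x and x' commute, so cancellation also works in the other order and leaves
      only \<open>e\<close>, a power of x or a power of x'.\<close>
    have P_diff: "P i j = P (i - j) (j - i)" for i j
    proof -
      have "P i j = upw m e x (j - i) \<bullet> upw m e x' (i - j)"
        unfolding P_def using e True by (intro S.upw_cancel) auto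
      also have "\<dots> = P (i - j) (j - i)"
        by (cases "i \<le> j") (use P0 e in \<open>simp_all add: S.upw_unit\<close>)
      finally show ?thesis .
    qed
    have "P i j \<in> cyc m x \<union> cyc m x' \<union> {e}" for i j
    proof -
      consider "i - j = 0 \<and> j - i = 0" | d where "i - j = 0 \<and> j - i = Suc d" | d where "i - j = Suc d \<and> j - i = 0"
        by (metis diff_is_0_eq' nat_le_linear not0_implies_Suc)
      then have "P i j = e \<or> P i j \<in> cyc m x \<or> P i j \<in> cyc m x'"
      proof cases
        case 1
        then show ?thesis using P_diff[of i j] e0 by metis
      next
        case 2
        then have "P i j = P 0 (Suc d)" using P_diff[of i j] by metis
        then show ?thesis unfolding cx by blast
      next
        case 3
        then have "P i j = P (Suc d) 0" using P_diff[of i j] by metis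
        then show ?thesis unfolding cx' by blast
      qed
      then show ?thesis by blast
    qed
    then have "gen m {x, x'} \<subseteq> cyc m x \<union> cyc m x' \<union> {e}" unfolding gen by blast
    moreover have "cyc m x \<union> cyc m x' \<union> {e} \<subseteq> gen m {x, x'}"
      unfolding gen cx cx' using e0 by blast
    ultimately have g: "gen m {x, x'} = {} \<union> cyc m x \<union> cyc m x' \<union> {e}" by blast
    have cl: "mclosed m {}" "mclosed m ({} \<union> cyc m x)" "mclosed m ({} \<union> cyc m x')"
      by (simp_all add: S.mclosed_cyc) (simp add: mclosed_def)
    show ?thesis
      by (rule unit_case[OF C eC empty_subsetI cl e(1-5) _ idem g xgen]) simp
  next
    case False
    define I where "I = {P (Suc i) (Suc j) |i j. True}"
    have Ix: "I \<union> cyc m x = {P i (Suc j) |i j. True}"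
    proof -
      have "P i (Suc j) \<in> I \<union> cyc m x" for i j
        unfolding I_def cx by (cases i) blast+
      then show ?thesis unfolding I_def cx by blast
    qed
    have Ix': "I \<union> cyc m x' = {P (Suc i) j |i j. True}"
    proof -
      have "P (Suc i) j \<in> I \<union> cyc m x'" for i j
        unfolding I_def cx' by (cases j) blast+
      then show ?thesis unfolding I_def cx' by blast
    qed
    have g: "gen m {x, x'} = I \<union> cyc m x \<union> cyc m x' \<union> {e}"
    proof -
      have "P i j \<in> I \<union> cyc m x \<union> cyc m x' \<union> {e}" for i j
      proof (cases i)
        case 0
        then show ?thesis unfolding cx e0 by (cases j) blast+
      next
        case (Suc k)
        then have "P i j \<in> I \<union> cyc m x'" unfolding Ix' by blast
        then show ?thesis by blast
      qed
      moreover have "I \<union> cyc m x \<union> cyc m x' \<union> {e} \<subseteq> {P i j |i j. True}"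
        unfolding I_def cx cx' using e0 by blast
      ultimately show ?thesis unfolding gen by blast
    qed
    then have IC: "I \<subseteq> C" using gen_C[of "{x, x'}"] C by blast
    have cl: "mclosed m I" "mclosed m (I \<union> cyc m x)" "mclosed m (I \<union> cyc m x')"
      unfolding Ix Ix' unfolding I_def mclosed_def by (auto simp: P_mult simp del: diff_Suc_Suc) blast+
    have eI: "e \<notin> I"
    proof
      assume "e \<in> I"
      then obtain i j where ij: "e = P (Suc i) (Suc j)" by (auto simp: I_def)
      \<comment> \<open>With e = x' v one gets x = x x' v = e v = v, hence x' x = e, the excluded
        case.\<close>
      define v where "v = P i (Suc j)"
      have "P (Suc i) (Suc j) = x' \<bullet> v"
        unfolding v_def P_def S.upw_Suc_left[OF e(1,4,5)] by (rule S.assoc)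
      with ij have v: "e = x' \<bullet> v" by simp
      have "P 0 0 \<bullet> v = v" unfolding v_def P_mult by simp
      then have "e \<bullet> v = v" unfolding e0[symmetric] .
      then have "x = v" using v e S.assoc by metis
      then show False using v False by simp
    qed
    show ?thesis by (rule unit_case[OF C eC IC cl e(1-5) eI idem g xgen])
  qed
qed

end

section \<open>Elements with a left unit\<close>

text \<open>The elements a^k b with k >= 0 and b in \<open>B\<close>: the shape to which words in x
  and x' will be reduced, with \<open>a\<close> = x'.\<close>

inductive_set lmults :: "('a \<Rightarrow> 'a \<Rightarrow> 'a) \<Rightarrow> 'a \<Rightarrow> 'a set \<Rightarrow> 'a set" for m a B where
  lmults_base: "b \<in> B \<Longrightarrow> b \<in> lmults m a B"
| lmults_step: "u \<in> lmults m a B \<Longrightarrow> m a u \<in> lmults m a B"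

context sgp
begin

lemma pw_left_unit: "e \<bullet> x = x \<Longrightarrow> e \<bullet> pw m x k = pw m x k"
  by (induction k) (simp_all flip: assoc)

lemma pw_right_unit: "x \<bullet> e = x \<Longrightarrow> pw m x k \<bullet> e = pw m x k"
  by (induction k) (simp_all add: assoc)

text \<open>A unit of \<open>t\<close> fixes all powers of \<open>t\<close> and a zero absorbs them;
  this is the converse of \<open>unit_or_zero\<close>.\<close>

lemma mclosed_unit_or_zero:
  assumes "g \<bullet> g = g" "g \<bullet> t = t \<and> t \<bullet> g = t \<or> g \<bullet> t = g \<and> t \<bullet> g = g"
  shows "mclosed m ({g} \<union> cyc m t)"
proof -
  have "g \<bullet> pw m t k \<in> {g} \<union> cyc m t \<and> pw m t k \<bullet> g \<in> {g} \<union> cyc m t" for k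
  proof (cases "g \<bullet> t = t")
    case True
    then have "t \<bullet> g = t" using assms by metis
    then show ?thesis using True by (simp add: pw_left_unit pw_right_unit cyc_def)
  next
    case False
    then have z: "g \<bullet> t = g" "t \<bullet> g = g" using assms by auto
    have "g \<bullet> pw m t k = g \<and> pw m t k \<bullet> g = g"
      by (induction k) (simp_all add: z assoc flip: assoc[of g])
    then show ?thesis by simp
  qed
  then show ?thesis
    using assms(1) mclosedD[OF mclosed_cyc] by (auto simp: mclosed_def cyc_def)
qed

text \<open>As g t = t, an inner \<open>g\<close> disappears in front of \<open>t\<close>, so (t
  g)^k = t^k g. Everything generated by \<open>g\<close> and \<open>t\<close> is thus g, t^k or t^k
  g.\<close>

lemma
  assumes gg: "g \<bullet> g = g" and gt: "g \<bullet> t = t"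
  shows left_unit_pw_mult: "pw m t k \<bullet> g = pw m (t \<bullet> g) k"
    and mclosed_left_unit_pws: "mclosed m (cyc m t \<union> cyc m (t \<bullet> g))"
    and mclosed_left_unit: "mclosed m ({g} \<union> cyc m t \<union> cyc m (t \<bullet> g))"
proof -
  have 1: "pw m t k \<bullet> g = pw m (t \<bullet> g) k" for k
  proof (induction k)
    case (Suc k)
    have "pw m (t \<bullet> g) (Suc k) = (pw m t k \<bullet> (g \<bullet> t)) \<bullet> g"
      using Suc by (simp flip: assoc)
    then show ?case using gt by simp
  qed simp
  show "pw m t k \<bullet> g = pw m (t \<bullet> g) k" by (rule 1)
  have g1: "g \<bullet> pw m t k = pw m t k" for k using pw_left_unit gt .
  have g2: "g \<bullet> pw m (t \<bullet> g) k = pw m (t \<bullet> g) k" for k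
    by (intro pw_left_unit) (simp add: gt flip: assoc)
  have g3: "pw m (t \<bullet> g) k \<bullet> g = pw m (t \<bullet> g) k" for k
    by (intro pw_right_unit) (simp add: gg assoc)
  have 2: "pw m (t \<bullet> g) k \<bullet> pw m t l = pw m t (Suc (k + l))" for k l
  proof -
    have "pw m (t \<bullet> g) k \<bullet> pw m t l = pw m t k \<bullet> (g \<bullet> pw m t l)" by (simp flip: 1 add: assoc)
    then show ?thesis by (simp only: g1 pw_add)
  qed
  have 3: "pw m t k \<bullet> pw m (t \<bullet> g) l = pw m (t \<bullet> g) (Suc (k + l))" for k l
  proof -
    have "pw m t k \<bullet> pw m (t \<bullet> g) l = (pw m t k \<bullet> pw m t l) \<bullet> g" by (simp only: 1[symmetric] assoc)
    then show ?thesis by (simp only: pw_add 1)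
  qed
  show c: "mclosed m (cyc m t \<union> cyc m (t \<bullet> g))"
    unfolding mclosed_def cyc_def using 2 3 pw_add by (auto simp del: pw.simps)
  show "mclosed m ({g} \<union> cyc m t \<union> cyc m (t \<bullet> g))"
    unfolding mclosed_def
  proof (intro ballI)
    have 4: "pw m (t \<bullet> g) k \<in> cyc m (t \<bullet> g)" for k by (simp add: cyc_def)
    have 5: "g \<bullet> u \<in> {u, g} \<and> (u \<bullet> g = g \<or> u \<bullet> g \<in> cyc m (t \<bullet> g))"
      if "u \<in> {g} \<union> cyc m t \<union> cyc m (t \<bullet> g)" for u
    proof -
      from that consider "u = g" | k where "u = pw m t k" | k where "u = pw m (t \<bullet> g) k"
        unfolding cyc_def by blast
      then show ?thesis by cases (simp_all only: gg g1 g2 g3 1 4 insert_iff simp_thms)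
    qed
    fix a b
    assume "a \<in> {g} \<union> cyc m t \<union> cyc m (t \<bullet> g)" "b \<in> {g} \<union> cyc m t \<union> cyc m (t \<bullet> g)"
    then show "a \<bullet> b \<in> {g} \<union> cyc m t \<union> cyc m (t \<bullet> g)"
      using 5[of a] 5[of b] mclosedD[OF c, of a b] by (cases "a = g"; cases "b = g") auto
  qed
qed

end

context sbij
begin

text \<open>The element \<open>x e\<close> generates together with \<open>x'\<close> a bicyclic semigroup with unit \<open>e\<close>, so
  the image \<open>g\<close> of \<open>e\<close> is a unit for the images \<open>w\<close> of \<open>x e\<close> and \<open>y\<close> of \<open>x'\<close>. It
  remains to see on which side \<open>g\<close> is a unit of \<open>t = \<phi> x\<close>. On the wrong side \<open>t y\<close> would be an
  idempotent that forms a one-sided zero band with \<open>g\<close>; its preimage can only be \<open>e\<close>, and then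
  \<open>x' x\<close> is not generated.\<close>

lemma left_unit_case_aux:
  assumes C: "x \<in> C" "x' \<in> C" and idem: "x \<bullet> x \<noteq> x" "x' \<bullet> x' \<noteq> x'"
    and e: "x \<bullet> x' = e" "e \<bullet> x = x" "e \<bullet> x' = x'" "x' \<bullet> e = x'"
    and ne: "x \<bullet> e \<noteq> x" "x' \<bullet> (x \<bullet> e) \<noteq> e"
    and wy: "\<phi> (x \<bullet> e) \<star> \<phi> x' = \<phi> e"
  shows "\<exists>s\<in>\<phi> ` C. \<phi> x \<star> s \<star> \<phi> x = \<phi> x"
proof -
  define x1 where "x1 = x \<bullet> e"
  define t y g w where "t = \<phi> x" and "y = \<phi> x'" and "g = \<phi> e" and "w = \<phi> x1"
  note defs = t_def y_def g_def w_def
  have ee: "e \<bullet> e = e" using e S.assoc by metis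
  have eC: "e \<in> C" using mult_C C e(1) by metis
  have x1C: "x1 \<in> C" using mult_C C eC by (simp add: x1_def)
  have x1: "x1 \<bullet> e = x1" "e \<bullet> x1 = x1" "x1 \<bullet> x' = e" "x1 \<bullet> x = x \<bullet> x" "x \<bullet> e = x1"
    unfolding x1_def using e ee by (simp_all add: S.assoc flip: S.assoc[of e])
  have x1_idem: "x1 \<bullet> x1 \<noteq> x1"
  proof
    assume "x1 \<bullet> x1 = x1"
    then have "x1 = e" using x1 S.assoc by metis
    then show False using x1(4) e(2) idem(1) by simp
  qed
  have gw: "g \<star> w = w" "w \<star> g = w" and gy: "g \<star> y = y" "y \<star> g = y"
    using unit_pair[OF x1C C(2) x1_idem idem(2) ee x1(2,1) e(3,4) x1(3)] by (auto simp: defs)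
  have wy: "w \<star> y = g" using wy by (simp add: defs x1_def)
  have gg: "g \<star> g = g" using idem_iff eC ee by (simp add: defs)
  have injs: "inj (pw m x)" "inj (pw m x1)" "inj (pw n t)" "inj (pw n w)" "inj (pw n y)"
    using S_tf T_tf C x1C idem x1_idem by (auto simp: defs)
  have cyc_im: "\<phi> ` cyc m x = cyc n t" "\<phi> ` cyc m x1 = cyc n w" "\<phi> ` cyc m x' = cyc n y"
    using image_cyc C x1C by (auto simp: defs)
  note cycC = cyc_C[OF C(1)] cyc_C[OF x1C]
  have gn: "g \<notin> cyc n t" "g \<notin> cyc n w"
    using T.inj_pw_not_idem[OF injs(3)] T.inj_pw_not_idem[OF injs(4)] gg by blast+
  \<comment> \<open>If x e = x^(k+1), then x^2 = (x e) x = x^(k+2), so k = 0 and x e = x.\<close>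
  have x1_cyc: "x1 \<notin> cyc m x"
  proof
    assume "x1 \<in> cyc m x"
    then obtain k where k: "x1 = pw m x k" by (auto simp: cyc_def)
    then have "pw m x (Suc 0) = pw m x (Suc k)" using x1(4) by simp
    then have "Suc 0 = Suc k" by (rule injD[OF injs(1)])
    then show False using k ne x1 by simp
  qed
  have x1_e: "x1 \<noteq> e" using x1_idem ee by blast
  have w_new: "w \<notin> cyc n t" "w \<noteq> g"
    using x1_cyc image_in_iff[OF x1C cycC(1)] x1_e image_eq_iff[OF x1C eC] by (auto simp: defs cyc_im)
  have A: "mclosed n ({g} \<union> cyc n t \<union> cyc n w)" and B: "mclosed n (cyc n t \<union> cyc n w)"
    using S.mclosed_left_unit[OF ee e(2)] S.mclosed_left_unit_pws[OF ee e(2)]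
      sub_iff[of "{e} \<union> cyc m x \<union> cyc m x1"] sub_iff[of "cyc m x \<union> cyc m x1"] cycC eC
    by (simp_all add: image_Un x1(5) cyc_im g_def)
  \<comment> \<open>By \<open>mclosed_unit_or_zero\<close>, \<open>g\<close> is therefore neither a
    two-sided unit nor a zero of \<open>t\<close>.\<close>
  have not_closed: "\<not> mclosed n ({g} \<union> cyc n t)"
  proof
    assume "mclosed n ({g} \<union> cyc n t)"
    then have "mclosed m ({e} \<union> cyc m x)"
      using sub_iff[of "{e} \<union> cyc m x"] cycC eC by (simp add: g_def cyc_im)
    then have "x \<bullet> e \<in> {e} \<union> cyc m x" by (rule mclosedD) (auto simp: S.cyc_self)
    then show False using x1_cyc x1_e x1(5) by simp
  qed
  have "g \<star> t \<in> {g} \<union> cyc n t \<union> cyc n w" "t \<star> g \<in> {g} \<union> cyc n t \<union> cyc n w"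
    using mclosedD[OF A] T.cyc_self[of t] by auto
  then have gt_cases: "g \<star> t = g \<or> g \<star> t = t \<or> g \<star> t \<in> cyc n w"
    and tg_cases: "t \<star> g = g \<or> t \<star> g = t \<or> t \<star> g \<in> cyc n w"
    using T.left_unit_of_cyc[OF injs(3) gg] T.right_unit_of_cyc[OF injs(3) gg] by auto
  have w_id: "v = w" if "v \<in> cyc n w" "g \<star> v = w \<or> v \<star> g = w" for v
    using that T.pw_left_unit[OF gw(1)] T.pw_right_unit[OF gw(2)] by (auto simp: cyc_def)
  have t_pow: "g \<star> v = g" if "v \<in> cyc n t" "g \<star> t = g" for v
  proof -
    have "g \<star> pw n t k = g" for k by (induction k) (simp_all add: that flip: T.assoc)
    then show ?thesis using that by (auto simp: cyc_def)
  qed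
  have t_pow': "v \<star> g = g" if "v \<in> cyc n t" "t \<star> g = g" for v
  proof -
    have "pw n t k \<star> g = g" for k by (induction k) (simp_all add: that T.assoc)
    then show ?thesis using that by (auto simp: cyc_def)
  qed
  \<comment> \<open>If g t = g, then g (t w) = w forces t w = w, and t g = t w y = w y = g makes
    \<open>g\<close> a zero of \<open>t\<close>.\<close>
  have "g \<star> t \<noteq> g"
  proof
    assume gt: "g \<star> t = g"
    have "t \<star> w \<in> cyc n t \<union> cyc n w" using mclosedD[OF B] T.cyc_self by blast
    moreover have "g \<star> (t \<star> w) = w" using gt gw by (simp flip: T.assoc)
    ultimately have "t \<star> w = w" using w_id t_pow[OF _ gt] w_new by auto
    then have "t \<star> g = g" using wy T.assoc by metis
    then show False using not_closed T.mclosed_unit_or_zero[OF gg] gt by blast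
  qed
  \<comment> \<open>If t g = g, then w t = w, so w (g t) = w. This keeps g t out of
    \<open>cyc n w\<close>, so g t = t, and t t = t g t = g t = t.\<close>
  have "t \<star> g \<noteq> g"
  proof
    assume tg: "t \<star> g = g"
    have "w \<star> t \<in> cyc n t \<union> cyc n w" using mclosedD[OF B] T.cyc_self by blast
    moreover have "(w \<star> t) \<star> g = w" using tg gw by (simp add: T.assoc)
    ultimately have wt: "w \<star> t = w" using w_id t_pow'[OF _ tg] w_new by auto
    have ww: "w \<star> v \<noteq> w" if "v \<in> cyc n w" for v
    proof
      assume "w \<star> v = w"
      moreover obtain k where "v = pw n w k" using \<open>v \<in> cyc n w\<close> by (auto simp: cyc_def)
      ultimately have "pw n w (Suc k) = pw n w 0" by (simp only: T.pw_Suc_left pw.simps(1))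
      then have "Suc k = 0" by (rule injD[OF injs(4)])
      then show False by simp
    qed
    have "w \<star> (g \<star> t) = w" using wt gw by (simp flip: T.assoc)
    then have "g \<star> t = t" using gt_cases \<open>g \<star> t \<noteq> g\<close> ww by blast
    then have "t \<star> t = t" using tg T.assoc by metis
    then show False using T.inj_pw_not_idem[OF injs(3) T.cyc_self] by blast
  qed
  define U1 where "U1 = gen m {x1, x'}"
  define V1 where "V1 = gen n {w, y}"
  have V1: "V1 = \<phi> ` U1" using image_gen[of "{x1, x'}"] x1C C by (simp add: V1_def U1_def defs)
  have U1C: "U1 \<subseteq> C" unfolding U1_def using gen_C x1C C by simp
  have V1_closed: "mclosed n V1" unfolding V1_def by (rule mclosed_gen)
  have V1_gens: "w \<in> V1" "y \<in> V1" unfolding V1_def by (simp_all add: gen_base)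
  then have gV1: "g \<in> V1" using wy mclosedD[OF V1_closed] by metis
  have V1_unit: "g \<star> v = v \<and> v \<star> g = v" if "v \<in> V1" for v
    using that unfolding V1_def
    by induction (auto simp: gw gy T.assoc simp flip: T.assoc[of g])
  have U1_unit: "v \<bullet> e = v" if "v \<in> U1" for v
    using that unfolding U1_def by induction (auto simp: x1 e S.assoc)
  \<comment> \<open>Otherwise the idempotent x' x lies in \<open>U1\<close>, where \<open>e\<close>
    is a right unit, and x = x x' x = x x' x e = x e. The bad cases below are refuted by showing
    that this set is closed.\<close>
  have no_V1_t: "\<not> mclosed n (V1 \<union> cyc n t)"
  proof
    assume "mclosed n (V1 \<union> cyc n t)"
    then have "mclosed m (U1 \<union> cyc m x)"
      using sub_iff[of "U1 \<union> cyc m x"] cycC U1C by (simp add: V1 image_Un cyc_im)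
    moreover have "x' \<in> U1 \<union> cyc m x" "x \<in> U1 \<union> cyc m x"
      using S.cyc_self by (auto simp: U1_def gen_base)
    ultimately have "x' \<bullet> x \<in> U1 \<union> cyc m x" by (rule mclosedD)
    moreover have "(x' \<bullet> x) \<bullet> (x' \<bullet> x) = x' \<bullet> x" using e S.assoc by metis
    ultimately have "x' \<bullet> x \<in> U1" using S.inj_pw_not_idem[OF injs(1)] by blast
    then have "(x' \<bullet> x) \<bullet> e = x' \<bullet> x" by (rule U1_unit)
    then have "x \<bullet> e = x" using e S.assoc by metis
    then show False using ne by blast
  qed
  have cyc_w_V1: "cyc n w \<subseteq> V1" using T.cyc_least[OF V1_closed V1_gens(1)] .
  show ?thesis
  proof (cases "g \<star> t = t")
    case True
    then have "t \<star> g \<noteq> t" using not_closed T.mclosed_unit_or_zero[OF gg] by blast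
    then obtain k where k: "t \<star> g = pw n w k"
      using tg_cases \<open>t \<star> g \<noteq> g\<close> by (auto simp: cyc_def)
    \<comment> \<open>This gives t y^(k+1) = (t g) y^(k+1) = w^(k+1) y^(k+1) = g, and
      \<open>g\<close> is a left unit of \<open>t\<close>, so y^(k+1) serves as
      \<open>s\<close>.\<close>
    have wky: "pw n w k \<star> pw n y k = g" for k
    proof (induction k)
      case (Suc k)
      have "pw n w (Suc k) \<star> pw n y (Suc k) = pw n w k \<star> ((w \<star> y) \<star> pw n y k)"
        by (simp only: T.pw_Suc_left[of y] pw.simps(2)[of n w] T.assoc)
      then show ?case using Suc T.pw_left_unit[OF gy(1)] wy by simp
    qed (use wy in simp)
    have "t \<star> pw n y k = (t \<star> g) \<star> pw n y k"
      using T.pw_left_unit[OF gy(1)] by (simp add: T.assoc)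
    then have "t \<star> pw n y k \<star> t = t" using k wky True by simp
    moreover have "pw n y k \<in> \<phi> ` C" using cyc_im(3) cyc_C[OF C(2)] unfolding cyc_def by blast
    ultimately show ?thesis by (auto simp: defs)
  next
    case False
    then have gtw: "g \<star> t \<in> cyc n w" using gt_cases \<open>g \<star> t \<noteq> g\<close> by blast
    show ?thesis
    proof (cases "t \<star> g = t")
      case tg: False
      then have tgw: "t \<star> g \<in> cyc n w" using tg_cases \<open>t \<star> g \<noteq> g\<close> by blast
      \<comment> \<open>\<open>g\<close> is the identity of \<open>V1\<close>, so t v = (t g) v and
        v t = v (g t).\<close>
      have tv: "t \<star> v \<in> V1" and vt: "v \<star> t \<in> V1" if "v \<in> V1" for v
      proof -
        have "(t \<star> g) \<star> v \<in> V1" "v \<star> (g \<star> t) \<in> V1"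
          using that gtw tgw cyc_w_V1 mclosedD[OF V1_closed] by blast+
        then show "t \<star> v \<in> V1" "v \<star> t \<in> V1"
          using V1_unit[OF that] T.assoc[of t g v] T.assoc[of v g t] by metis+
      qed
      have "pw n t k \<star> v \<in> V1 \<and> v \<star> pw n t k \<in> V1" if "v \<in> V1" for v k
        using that
      proof (induction k arbitrary: v)
        case (Suc k)
        then have "pw n t k \<star> (t \<star> v) \<in> V1" "(v \<star> pw n t k) \<star> t \<in> V1"
          using tv vt by blast+
        then show ?case by (simp add: T.assoc)
      qed (simp add: tv vt)
      then have "mclosed n (V1 \<union> cyc n t)"
        using mclosedD[OF V1_closed] mclosedD[OF T.mclosed_cyc[of t]]
        unfolding mclosed_def by (auto simp: cyc_def)
      then show ?thesis using no_V1_t by blast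
    next
      case tg: True
      \<comment> \<open>The wrong side. \<open>w\<close> is generated by \<open>g\<close> and
        \<open>t\<close>, hence a power of g t, and g t is a power of \<open>w\<close>; comparing
        exponents gives g t = w.\<close>
      have "x1 \<in> gen m {e, x}" unfolding x1_def by (simp add: gen_base gen_mult)
      then have "w \<in> gen n {g, t}" using image_gen[of "{e, x}"] eC C by (auto simp: defs)
      moreover have "gen n {g, t} \<subseteq> {g} \<union> cyc n t \<union> cyc n (g \<star> t)"
        using sgp.mclosed_left_unit[OF T.sgp_opp, of g t] gg tg T.cyc_self
        by (intro gen_least) (auto simp: opp_apply)
      ultimately have "w \<in> cyc n (g \<star> t)" using w_new by blast
      moreover obtain k where k: "g \<star> t = pw n w k" using gtw by (auto simp: cyc_def)
      ultimately obtain l where "pw n w 0 = pw n w (k + l + k * l)"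
        by (auto simp: cyc_def T.pw_pw)
      then have "0 = k + l + k * l" by (rule injD[OF injs(4)])
      then have gt: "g \<star> t = w" using k by simp
      \<comment> \<open>Here g p = w y = g and p g = p, so \<open>p\<close> is idempotent. The aim
        is p = g.\<close>
      define p where "p = t \<star> y"
      have p: "g \<star> p = g" "p \<star> g = p" using gt wy gy T.assoc unfolding p_def by metis+
      then have pp: "p \<star> p = p" using T.assoc by metis
      have "p \<in> \<phi> ` gen m {x, x'}"
        unfolding p_def defs using C gen_self[of "{x, x'}" m]
        by (intro mult_image gen_C mclosed_gen) auto
      then obtain q where q: "q \<in> gen m {x, x'}" "p = \<phi> q" by blast
      have qC: "q \<in> C" using q gen_C[of "{x, x'}"] C by blast
      have "mclosed n (\<phi> ` {e, q})" using p pp gg by (simp add: mclosed_def q(2) g_def)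
      then have "mclosed m {e, q}" using sub_iff[of "{e, q}"] eC qC by simp
      then have qe: "q \<bullet> e = e \<or> q \<bullet> e = q" using mclosedD[of m "{e, q}" q e] by auto
      have qq: "q \<bullet> q = q" using idem_iff[OF qC] pp q by simp
      \<comment> \<open>Since x x' = e is a left unit, words in x and x' reduce to x'^k b, where b
        is \<open>e\<close>, a power of x or a power of x e.\<close>
      define R where "R = lmults m x' ({e} \<union> cyc m x \<union> cyc m x1)"
      have eR: "e \<bullet> u = u" if "u \<in> R" for u
        using that unfolding R_def
      proof cases
        case lmults_base
        then show ?thesis
          using ee S.pw_left_unit[OF e(2)] S.pw_left_unit[OF x1(2)] by (auto simp: cyc_def)
      qed (simp add: e(3) flip: S.assoc)
      have xR: "x \<bullet> u \<in> R" if "u \<in> R" for u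
        using that unfolding R_def
      proof cases
        case lmults_base
        have "x \<bullet> e \<in> cyc m x1" using x1 S.cyc_self by simp
        then have "x \<bullet> u \<in> {e} \<union> cyc m x \<union> cyc m x1"
          using lmults_base mclosedD[OF S.mclosed_left_unit_pws[OF ee e(2)], of x] S.cyc_self[of x]
          by (auto simp: x1(5))
        then show "x \<bullet> u \<in> lmults m x' ({e} \<union> cyc m x \<union> cyc m x1)"
          by (rule lmults.lmults_base)
      next
        case (lmults_step v)
        then have "x \<bullet> u = v" using eR[of v] e(1) by (simp add: R_def flip: S.assoc)
        then show "x \<bullet> u \<in> lmults m x' ({e} \<union> cyc m x \<union> cyc m x1)" using lmults_step by simp
      qed
      have x'R: "x' \<bullet> u \<in> R" if "u \<in> R" for u
        using that unfolding R_def by (rule lmults.lmults_step)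
      \<comment> \<open>The elements whose left multiplication preserves \<open>R\<close> form a
        closed set, so it suffices to check the generators.\<close>
      have "gen m {x, x'} \<subseteq> {u \<in> R. \<forall>v\<in>R. u \<bullet> v \<in> R}"
      proof (rule gen_least)
        have "e \<in> R" "x \<in> R" unfolding R_def by (rule lmults.lmults_base, simp add: S.cyc_self)+
        then have "x' \<in> R" using x'R e(4) by metis
        then show "{x, x'} \<subseteq> {u \<in> R. \<forall>v\<in>R. u \<bullet> v \<in> R}" using \<open>x \<in> R\<close> xR x'R by auto
      qed (auto simp: mclosed_def S.assoc)
      then have qR: "q \<in> R" using q by blast
      have Ue: "u \<bullet> e \<in> U1 \<and> e \<bullet> u = u" if "u \<in> gen m {x, x'}" for u
        using that
      proof induction
        case (gen_base a)
        then show ?case using x1 e by (auto simp: U1_def intro: gen.gen_base)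
      next
        case (gen_mult a b)
        then have "(a \<bullet> b) \<bullet> e = (a \<bullet> e) \<bullet> (b \<bullet> e)" by (metis S.assoc)
        moreover have "(a \<bullet> e) \<bullet> (b \<bullet> e) \<in> U1"
          using gen_mult gen.gen_mult[of "a \<bullet> e" m "{x1, x'}" "b \<bullet> e"] by (simp add: U1_def)
        moreover have "e \<bullet> (a \<bullet> b) = a \<bullet> b" using gen_mult by (simp flip: S.assoc)
        ultimately show ?case by simp
      qed
      \<comment> \<open>If q e = q, then \<open>p\<close> lies in \<open>V1\<close>, so p = g p = g.
        If q e = e and q = x' v, then z = v e satisfies x' z = e, so x e = z and x' (x e) = e, which
        is excluded.\<close>
      have "p = g"
        using qe
      proof
        assume "q \<bullet> e = q"
        then have "p \<in> V1" using Ue[OF q(1)] q(2) by (auto simp: V1)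
        then show "p = g" using V1_unit p by metis
      next
        assume qe: "q \<bullet> e = e"
        from qR have "q = e" unfolding R_def
        proof cases
          case lmults_base
          then show ?thesis
            using S.inj_pw_not_idem[OF injs(1)] S.inj_pw_not_idem[OF injs(2)] qq by blast
        next
          case (lmults_step v)
          define z where "z = v \<bullet> e"
          have "e \<bullet> v = v" using eR lmults_step by (simp add: R_def)
          then have "e \<bullet> z = z" by (simp add: z_def flip: S.assoc)
          moreover have "x' \<bullet> z = e" using qe lmults_step by (simp add: z_def S.assoc)
          ultimately have "x' \<bullet> x1 = e" using x1 S.assoc by metis
          then show ?thesis using ne x1 by simp
        qed
        then show "p = g" using q g_def by simp
      qed
      then have ty: "t \<star> y = g" by (simp add: p_def)
      \<comment> \<open>With t y = g, products v t^k fall into \<open>V1\<close> and products t^k v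
        into \<open>V1 \<union> cyc n t\<close>, against \<open>no_V1_t\<close>.\<close>
      have tw: "t \<star> w = t \<star> t" using tg gt by (metis T.assoc)
      have vt: "v \<star> t \<in> V1" if "v \<in> V1" for v
        using V1_unit[OF that] gt mclosedD[OF V1_closed that V1_gens(1)] by (metis T.assoc)
      have 1: "v \<star> pw n t k \<in> V1" if "v \<in> V1" for v k
        using that by (induction k arbitrary: v) (simp_all add: vt flip: T.assoc)
      have 2: "pw n t k \<star> v \<in> V1 \<union> cyc n t" if "v \<in> V1" for v k
        using that unfolding V1_def
      proof (induction v arbitrary: k)
        case (gen_base a)
        show ?case
        proof (cases "a = w")
          case True
          have "pw n t k \<star> w = pw n t (Suc k)"
            by (cases k) (simp_all add: tw T.assoc)
          then show ?thesis using True by (auto simp: cyc_def simp del: pw.simps)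
        next
          case False
          then have "a = y" using gen_base by simp
          moreover have "pw n t k \<star> y = g \<or> pw n t k \<star> y \<in> cyc n t"
            by (cases k) (auto simp: ty tg T.assoc T.pw_right_unit cyc_def)
          ultimately show ?thesis using gV1 by (auto simp: V1_def)
        qed
      next
        case (gen_mult a b)
        show ?case
        proof (cases "pw n t k \<star> a \<in> cyc n t")
          case True
          then obtain j where "pw n t k \<star> a = pw n t j" by (auto simp: cyc_def)
          then show ?thesis using gen_mult(4)[of j] by (simp flip: T.assoc)
        next
          case False
          then have "pw n t k \<star> a \<in> gen n {w, y}" using gen_mult(3)[of k] by blast
          then have "(pw n t k \<star> a) \<star> b \<in> gen n {w, y}" using gen_mult(2) by (rule gen.gen_mult)
          then show ?thesis by (simp add: T.assoc)
        qed
      qed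
      have "mclosed n (V1 \<union> cyc n t)"
        unfolding mclosed_def
      proof (intro ballI)
        fix a b
        assume ab: "a \<in> V1 \<union> cyc n t" "b \<in> V1 \<union> cyc n t"
        then consider "a \<in> V1" "b \<in> V1" | k where "a \<in> V1" "b = pw n t k"
          | k where "a = pw n t k" "b \<in> V1" | "a \<in> cyc n t" "b \<in> cyc n t"
          unfolding cyc_def by blast
        then show "a \<star> b \<in> V1 \<union> cyc n t"
          using mclosedD[OF V1_closed, of a b] mclosedD[OF T.mclosed_cyc, of a t b] 1 2
          by cases auto
      qed
      then show ?thesis using no_V1_t by blast
    qed
  qed
qed

end

section \<open>Inverse pairs with comparable idempotents\<close>

context sbij
begin

text \<open>By \<open>unit_pair\<close> for x e and x', their images multiply to the image of
  \<open>e\<close> in one of the two orders. Reversing the target operation reduces the second order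
  to the first and keeps the conclusion.\<close>

lemma left_unit_case:
  assumes C: "x \<in> C" "x' \<in> C" and idem: "x \<bullet> x \<noteq> x" "x' \<bullet> x' \<noteq> x'"
    and e: "x \<bullet> x' = e" "e \<bullet> x = x" "e \<bullet> x' = x'" "x' \<bullet> e = x'"
    and ne: "x \<bullet> e \<noteq> x" "x' \<bullet> (x \<bullet> e) \<noteq> e"
  shows "\<exists>s\<in>\<phi> ` C. \<phi> x \<star> s \<star> \<phi> x = \<phi> x"
proof -
  have ee: "e \<bullet> e = e" using e S.assoc by metis
  have x1C: "x \<bullet> e \<in> C" using mult_C C e(1) by metis
  have x1: "(x \<bullet> e) \<bullet> e = x \<bullet> e" "e \<bullet> (x \<bullet> e) = x \<bullet> e" "(x \<bullet> e) \<bullet> x' = e"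
    using e ee by (metis S.assoc)+
  have "(x \<bullet> e) \<bullet> (x \<bullet> e) \<noteq> x \<bullet> e"
    using e idem(1) ne(1) S.assoc by metis
  from unit_pair[OF x1C C(2) this idem(2) ee x1(2,1) e(3,4) x1(3)]
  consider "\<phi> (x \<bullet> e) \<star> \<phi> x' = \<phi> e" | "opp n (\<phi> (x \<bullet> e)) (\<phi> x') = \<phi> e"
    by (auto simp: opp_apply)
  then show ?thesis
  proof cases
    case 1
    then show ?thesis by (rule left_unit_case_aux[OF assms])
  next
    case 2
    then show ?thesis
      using sbij.left_unit_case_aux[OF sbij_opp_right assms] by (simp add: opp_apply T.assoc)
  qed
qed

text \<open>In \<open>unit_pair\<close> one product of the images is a two-sided unit of
  \<open>\<phi> x\<close>, so \<open>\<phi> z\<close> serves as \<open>s\<close>.\<close>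

lemma unit_pair_regular:
  assumes C: "x \<in> C" "z \<in> C" and idem: "x \<bullet> x \<noteq> x"
    and e: "e \<bullet> e = e" "e \<bullet> x = x" "x \<bullet> e = x" "e \<bullet> z = z" "z \<bullet> e = z" "x \<bullet> z = e"
  shows "\<exists>s\<in>\<phi> ` C. \<phi> x \<star> s \<star> \<phi> x = \<phi> x"
proof -
  have "z \<bullet> z \<noteq> z"
    using e idem S.assoc by metis
  from unit_pair[OF C idem this e] have "\<phi> x \<star> \<phi> z \<star> \<phi> x = \<phi> x" by (metis T.assoc)
  then show ?thesis using C by blast
qed

text \<open>From f e f = f one gets x (e x') = x f e f x' = e, so e x' can replace x'. If also e f e
  = e, then e f is a two-sided unit of x and e x' f. Otherwise \<open>e\<close> is a left unit of x
  and a two-sided unit of e x', and the value of x e decides between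
  \<open>unit_pair_regular\<close> and \<open>left_unit_case\<close>.\<close>

lemma comparable_case:
  assumes idem_closed: "mclosed m {p \<in> C. p \<bullet> p = p}"
    and C: "x \<in> C" "x' \<in> C" and idem: "x \<bullet> x \<noteq> x"
    and x: "x \<bullet> x' \<bullet> x = x" "x' \<bullet> x \<bullet> x' = x'"
    and e: "e = x \<bullet> x'" and f: "f = x' \<bullet> x" and fef: "f \<bullet> e \<bullet> f = f"
  shows "\<exists>s\<in>\<phi> ` C. \<phi> x \<star> s \<star> \<phi> x = \<phi> x"
proof -
  have ex: "e \<bullet> x = x" "x \<bullet> f = x" "x' \<bullet> e = x'" "f \<bullet> x' = x'" "x \<bullet> x' = e" "x' \<bullet> x = f"
    using x by (auto simp: e f S.assoc)
  have eC: "e \<in> C" "f \<in> C" using mult_C C by (auto simp: e f)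
  have ee: "e \<bullet> e = e" and ff: "f \<bullet> f = f" using ex S.assoc by metis+
  have xex': "x \<bullet> (e \<bullet> x') = e"
    using ex fef S.assoc by metis
  have ef: "(e \<bullet> f) \<bullet> (e \<bullet> f) = e \<bullet> f"
    using mclosedD[OF idem_closed, of e f] eC ee ff by simp
  show ?thesis
  proof (cases "e \<bullet> f \<bullet> e = e")
    case True
    show ?thesis
    proof (rule unit_pair_regular[OF C(1) _ idem ef])
      show "e \<bullet> x' \<bullet> f \<in> C" using mult_C C eC by blast
      show "e \<bullet> f \<bullet> x = x" using True ex S.assoc by metis
      show "x \<bullet> (e \<bullet> f) = x" using fef ex S.assoc by metis
      show "e \<bullet> f \<bullet> (e \<bullet> x' \<bullet> f) = e \<bullet> x' \<bullet> f" using True S.assoc by metis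
      show "e \<bullet> x' \<bullet> f \<bullet> (e \<bullet> f) = e \<bullet> x' \<bullet> f" using fef S.assoc by metis
      show "x \<bullet> (e \<bullet> x' \<bullet> f) = e \<bullet> f" using xex' S.assoc by metis
    qed
  next
    case False
    have zC: "e \<bullet> x' \<in> C" using mult_C C eC by blast
    have z: "e \<bullet> (e \<bullet> x') = e \<bullet> x'" "e \<bullet> x' \<bullet> e = e \<bullet> x'" using ex ee S.assoc by metis+
    show ?thesis
    proof (cases "x \<bullet> e = x")
      case True
      then show ?thesis using unit_pair_regular[OF C(1) zC idem ee ex(1) _ z xex'] by blast
    next
      case ne: False
      show ?thesis
      proof (rule left_unit_case[OF C(1) zC idem _ xex' ex(1) z ne])
        show "e \<bullet> x' \<bullet> (x \<bullet> e) \<noteq> e" using False ex S.assoc by metis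
        \<comment> \<open>An idempotent e x' would equal \<open>e\<close>, because x (e x') = e;
          then x e = e and x = e x = x e x = x x.\<close>
        show "e \<bullet> x' \<bullet> (e \<bullet> x') \<noteq> e \<bullet> x'"
        proof
          assume zz: "e \<bullet> x' \<bullet> (e \<bullet> x') = e \<bullet> x'"
          have "e \<bullet> x' = (x \<bullet> (e \<bullet> x')) \<bullet> (e \<bullet> x')" using xex' z by simp
          also have "\<dots> = e" unfolding S.assoc[of x] zz by (rule xex')
          finally have "x \<bullet> e = e" using xex' by simp
          then show False using ex idem ne S.assoc by metis
        qed
      qed
    qed
  qed
qed

text \<open>Reversing the source operation interchanges \<open>e\<close> and
  \<open>f\<close>.\<close>

lemma comparable_case':
  assumes idem_closed: "mclosed m {p \<in> C. p \<bullet> p = p}"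
    and C: "x \<in> C" "x' \<in> C" and idem: "x \<bullet> x \<noteq> x"
    and x: "x \<bullet> x' \<bullet> x = x" "x' \<bullet> x \<bullet> x' = x'"
    and e: "e = x \<bullet> x'" and f: "f = x' \<bullet> x" and efe: "e \<bullet> f \<bullet> e = e"
  shows "\<exists>s\<in>\<phi> ` C. \<phi> x \<star> s \<star> \<phi> x = \<phi> x"
  using sbij.comparable_case[OF sbij_opp_left, of x x' f e] assms
  by (simp add: opp_apply S.assoc)

text \<open>Neither \<open>I \<union> {x, x', e}\<close> nor \<open>I \<union> {x, x', f}\<close> is
  closed, but dropping x or x' leaves a closed set. In the image this makes the two products of
  \<open>t\<close> and \<open>y\<close> equal to \<open>g\<close> and \<open>h\<close> in some
  order.\<close>

lemma square_case:
  assumes C: "x \<in> C" "x' \<in> C"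
    and e: "x \<bullet> x' = e" and f: "x' \<bullet> x = f"
    and ex: "e \<bullet> x = x" "x \<bullet> f = x" "x' \<bullet> e = x'" "f \<bullet> x' = x'"
    and gen: "gen m {x, x'} = I \<union> {x, x', e, f}"
    and I: "x \<notin> I" "x' \<notin> I" "e \<notin> I" "f \<notin> I"
    and dist: "e \<noteq> f" "x \<noteq> e" "x \<noteq> f" "x \<noteq> x'" "x' \<noteq> e" "x' \<noteq> f"
    and ideal: "\<And>u i. u \<in> I \<union> {x, x', e, f} \<Longrightarrow> i \<in> I \<Longrightarrow> u \<bullet> i \<in> I \<and> i \<bullet> u \<in> I"
    and prods: "x \<bullet> x \<in> I" "x' \<bullet> x' \<in> I" "x \<bullet> e \<in> I" "f \<bullet> x \<in> I" "x' \<bullet> f \<in> I" "e \<bullet> x' \<in> I"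
  shows "\<exists>s\<in>\<phi> ` C. \<phi> x \<star> s \<star> \<phi> x = \<phi> x"
proof -
  define t y g h I' where "t = \<phi> x" and "y = \<phi> x'" and "g = \<phi> e" and "h = \<phi> f" and "I' = \<phi> ` I"
  note defs = t_def y_def g_def h_def I'_def
  have U: "I \<union> {x, x', e, f} \<subseteq> C" unfolding gen[symmetric] using gen_C C by simp
  have ee: "e \<bullet> e = e" and ff: "f \<bullet> f = f" using ex e f S.assoc by metis+
  have notin: "t \<notin> I'" "y \<notin> I'" "g \<notin> I'" "h \<notin> I'"
    using I image_in_iff[of _ I] U by (auto simp: defs)
  have neq: "g \<noteq> h" "t \<noteq> g" "t \<noteq> h" "t \<noteq> y" "y \<noteq> g" "y \<noteq> h"
    using dist image_eq_iff U by (auto simp: defs)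
  have gg: "g \<star> g = g" and hh: "h \<star> h = h" using idem_iff ee ff U by (auto simp: defs)
  have im: "mclosed n (I' \<union> \<phi> ` A) \<longleftrightarrow> mclosed m (I \<union> A)" if "A \<subseteq> {x, x', e, f}" for A
    using sub_iff[of "I \<union> A"] that U by (auto simp: defs image_Un)
  have closed: "mclosed m (I \<union> A)"
    if "\<And>a b. a \<in> A \<Longrightarrow> b \<in> A \<Longrightarrow> a \<bullet> b \<in> I \<union> A" "A \<subseteq> {x, x', e, f}" for A
    unfolding mclosed_def using that ideal by blast
  have It: "mclosed n (I' \<union> {t})" and Iy: "mclosed n (I' \<union> {y})"
    using im[of "{x}"] im[of "{x'}"] closed[of "{x}"] closed[of "{x'}"] prods
    by (simp_all add: defs)
  have pairs: "mclosed n (I' \<union> {t, g})" "mclosed n (I' \<union> {y, g})"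
      "mclosed n (I' \<union> {t, h})" "mclosed n (I' \<union> {y, h})"
    using im[of "{x, e}"] im[of "{x', e}"] im[of "{x, f}"] im[of "{x', f}"]
      closed[of "{x, e}"] closed[of "{x', e}"] closed[of "{x, f}"] closed[of "{x', f}"]
      prods ex ee ff
    by (auto simp: defs)
  have V: "a \<star> b \<in> I' \<union> {t, y, g, h}" if "a \<in> {t, y}" "b \<in> {t, y}" for a b
  proof -
    have "a \<star> b \<in> \<phi> ` gen m {x, x'}"
      using C that gen_self[of "{x, x'}" m] by (intro mult_image gen_C mclosed_gen) (auto simp: defs)
    then show ?thesis by (auto simp: gen defs)
  qed
  have triple: "mclosed n (I' \<union> {t, y, k})"
    if "mclosed n (I' \<union> {t, k})" "mclosed n (I' \<union> {y, k})"
      "t \<star> y \<in> I' \<union> {t, y, k}" "y \<star> t \<in> I' \<union> {t, y, k}" for k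
    unfolding mclosed_def using that mclosedD[OF that(1)] mclosedD[OF that(2)] by blast
  have not_triple: "\<not> (t \<star> y \<in> I' \<union> {t, y, g} \<and> y \<star> t \<in> I' \<union> {t, y, g})"
      "\<not> (t \<star> y \<in> I' \<union> {t, y, h} \<and> y \<star> t \<in> I' \<union> {t, y, h})"
  proof -
    have "\<not> mclosed m (I \<union> {x, x', e})"
      using mclosedD[of m "I \<union> {x, x', e}" x' x] f I dist by auto
    then show "\<not> (t \<star> y \<in> I' \<union> {t, y, g} \<and> y \<star> t \<in> I' \<union> {t, y, g})"
      using triple[OF pairs(1,2)] im[of "{x, x', e}"] by (auto simp: defs)
    have "\<not> mclosed m (I \<union> {x, x', f})"
      using mclosedD[of m "I \<union> {x, x', f}" x x'] e I dist by auto
    then show "\<not> (t \<star> y \<in> I' \<union> {t, y, h} \<and> y \<star> t \<in> I' \<union> {t, y, h})"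
      using triple[OF pairs(3,4)] im[of "{x, x', f}"] by (auto simp: defs)
  qed
  \<comment> \<open>t y t = a t = t b lies in both closed sets, so it is \<open>t\<close> or lies in
    \<open>I'\<close>. The latter would put a = a a = (t y t) y into
    \<open>I' \<union> {y}\<close>.\<close>
  have "t \<star> y \<star> t = t"
    if ab: "t \<star> y = a" "y \<star> t = b" "a \<star> a = a" "a \<noteq> b" "t \<noteq> a" "t \<noteq> b" "a \<noteq> y" "a \<notin> I'"
      "mclosed n (I' \<union> {t, a})" "mclosed n (I' \<union> {t, b})" for a b
  proof -
    have "t \<star> y \<star> t \<in> I' \<union> {t, a}" using mclosedD[OF ab(9), of a t] ab(1) by simp
    moreover have "t \<star> y \<star> t \<in> I' \<union> {t, b}" using mclosedD[OF ab(10), of t b] ab(2) by (simp add: T.assoc)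
    ultimately have "t \<star> y \<star> t \<in> I' \<or> t \<star> y \<star> t = t" using ab(4) by auto
    moreover have False if "t \<star> y \<star> t \<in> I'"
    proof -
      have "a = (t \<star> y \<star> t) \<star> y" using ab(1,3) by (simp add: T.assoc)
      moreover have "(t \<star> y \<star> t) \<star> y \<in> I' \<union> {y}" using mclosedD[OF Iy] that by simp
      ultimately show False using ab(7,8) by simp
    qed
    ultimately show ?thesis by blast
  qed
  note key = this
  have "t \<star> y = g \<and> y \<star> t = h \<or> t \<star> y = h \<and> y \<star> t = g"
    using not_triple V[of t y] V[of y t] neq notin by auto
  then have "t \<star> y \<star> t = t"
    using key[of g h] key[of h g] gg hh neq notin pairs by metis
  then show ?thesis using C by (auto simp: defs)
qed

end

section \<open>Inverse pairs with incomparable idempotents\<close>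

locale inv_pair = sgp +
  fixes C :: "'a set" and x x' :: 'a
  assumes C_closed: "mclosed m C"
    and idem_closed: "mclosed m {p \<in> C. p \<bullet> p = p}"
    and xC: "x \<in> C" "x' \<in> C"
    and xx'x: "x \<bullet> x' \<bullet> x = x" and x'xx': "x' \<bullet> x \<bullet> x' = x'"
begin

lemma swap: "inv_pair m C x' x"
  by unfold_locales (fact C_closed idem_closed xC xx'x x'xx')+

abbreviation "E \<equiv> {p \<in> C. p \<bullet> p = p}"
abbreviation "e \<equiv> x \<bullet> x'"
abbreviation "f \<equiv> x' \<bullet> x"

text \<open>The order induced on the idempotents by inclusion of the ideals of the band \<open>E\<close> that they
  generate.\<close>

definition below :: "'a \<Rightarrow> 'a \<Rightarrow> bool" where
  "below p r \<longleftrightarrow> p \<bullet> r \<bullet> p = p"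

lemma mult_E: "p \<in> E \<Longrightarrow> q \<in> E \<Longrightarrow> p \<bullet> q \<in> E"
  using idem_closed by (rule mclosedD)

lemma mult_C: "a \<in> C \<Longrightarrow> b \<in> C \<Longrightarrow> a \<bullet> b \<in> C"
  using C_closed by (rule mclosedD)

lemma units: "e \<bullet> x = x" "x \<bullet> f = x" "x' \<bullet> e = x'" "f \<bullet> x' = x'"
  using xx'x x'xx' by (simp_all add: assoc)

lemma eE: "e \<in> E" and fE: "f \<in> E"
proof -
  have "e \<bullet> e = (e \<bullet> x) \<bullet> x'" "f \<bullet> f = (f \<bullet> x') \<bullet> x" by (simp_all only: assoc)
  then show "e \<in> E" "f \<in> E" unfolding units using mult_C xC by auto
qed

text \<open>As r v is idempotent, p r v = p, and then p r p = (p r)(p r) v = p r v = p.\<close>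

lemma below_mult:
  assumes "p \<in> E" "r \<in> E" "p = u \<bullet> r \<bullet> v" "r \<bullet> v \<in> E"
  shows "below p r"
proof -
  have prv: "p \<bullet> r \<bullet> v = p" using assms(3,4) by (simp add: assoc)
  have pr: "p \<bullet> r \<bullet> (p \<bullet> r) = p \<bullet> r" using mult_E[OF assms(1,2)] by simp
  have "p \<bullet> r \<bullet> p = p \<bullet> r \<bullet> (p \<bullet> r) \<bullet> v" using prv by (simp add: assoc)
  also have "\<dots> = p" unfolding pr by (rule prv)
  finally show ?thesis by (simp add: below_def)
qed

lemma below_trans:
  assumes "p \<in> E" "q \<in> E" "r \<in> E" "below p q" "below q r"
  shows "below p r"
proof (rule below_mult[where u = "p \<bullet> q" and v = "q \<bullet> p"])
  show "p = p \<bullet> q \<bullet> r \<bullet> (q \<bullet> p)"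
    using assms(4,5) unfolding below_def by (metis assoc)
qed (intro mult_E assms)+

text \<open>The inner x' x is \<open>f\<close>, and f p is idempotent: x p f p x' = x (f p)(f p) x'
  = x p x'.\<close>

lemma conj_E:
  assumes "p \<in> E"
  shows "x \<bullet> p \<bullet> x' \<in> E"
proof -
  have fp: "f \<bullet> p \<bullet> (f \<bullet> p) = f \<bullet> p" using mult_E[OF fE assms] by simp
  have "x \<bullet> p \<bullet> x' \<bullet> (x \<bullet> p \<bullet> x') = x \<bullet> f \<bullet> p \<bullet> (f \<bullet> p) \<bullet> x'"
    unfolding units(2) by (simp add: assoc)
  also have "\<dots> = x \<bullet> f \<bullet> p \<bullet> x'" using fp by (metis assoc)
  also have "\<dots> = x \<bullet> p \<bullet> x'" unfolding units(2) ..
  finally show ?thesis using assms mult_C xC by simp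
qed

text \<open>Conjugation by x sees only f p f, which is still below \<open>r\<close>; the product of
  the conjugates contains f p f r f p f.\<close>

lemma below_conj:
  assumes "p \<in> E" "r \<in> E" "below p r"
  shows "below (x \<bullet> p \<bullet> x') (x \<bullet> r \<bullet> x')"
proof -
  have "below (f \<bullet> p \<bullet> f) r"
  proof (rule below_mult[where u = "f \<bullet> p" and v = "p \<bullet> f"])
    show "f \<bullet> p \<bullet> f = f \<bullet> p \<bullet> r \<bullet> (p \<bullet> f)"
      using assms(3) unfolding below_def by (metis assoc)
  qed (intro mult_E fE assms)+
  then have q: "f \<bullet> p \<bullet> f \<bullet> r \<bullet> (f \<bullet> p \<bullet> f) = f \<bullet> p \<bullet> f" by (simp add: below_def)
  have c: "x \<bullet> p \<bullet> x' = x \<bullet> (f \<bullet> p \<bullet> f) \<bullet> x'"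
    using units by (metis assoc)
  have "x \<bullet> p \<bullet> x' \<bullet> (x \<bullet> r \<bullet> x') \<bullet> (x \<bullet> p \<bullet> x') = x \<bullet> p \<bullet> f \<bullet> r \<bullet> f \<bullet> p \<bullet> x'"
    by (simp add: assoc)
  also have "\<dots> = x \<bullet> f \<bullet> p \<bullet> f \<bullet> r \<bullet> f \<bullet> p \<bullet> (f \<bullet> x')" unfolding units ..
  also have "\<dots> = x \<bullet> (f \<bullet> p \<bullet> f \<bullet> r \<bullet> (f \<bullet> p \<bullet> f)) \<bullet> x'" by (simp only: assoc)
  also have "\<dots> = x \<bullet> p \<bullet> x'" unfolding q c ..
  finally show ?thesis by (simp add: below_def)
qed

text \<open>The middle part (f e)(f e) collapses to f e. As x e x' = x^2 x'^2, this is the inverse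
  equation for x^2 and x'^2.\<close>

lemma xxx'x'xx: "x \<bullet> e \<bullet> x' \<bullet> (x \<bullet> x) = x \<bullet> x"
proof -
  have fe: "f \<bullet> e \<bullet> (f \<bullet> e) = f \<bullet> e" using mult_E[OF fE eE] by simp
  have "x \<bullet> e \<bullet> x' \<bullet> (x \<bullet> x) = x \<bullet> f \<bullet> e \<bullet> f \<bullet> (e \<bullet> x)" unfolding units by (simp only: assoc)
  also have "\<dots> = x \<bullet> (f \<bullet> e \<bullet> (f \<bullet> e)) \<bullet> x" by (simp only: assoc)
  also have "\<dots> = x \<bullet> f \<bullet> (e \<bullet> x)" unfolding fe by (simp only: assoc)
  also have "\<dots> = x \<bullet> x" unfolding units ..
  finally show ?thesis .
qed

text \<open>The elements whose range is below that of \<open>x\<^sup>2\<close>, of \<open>x' x\<^sup>2\<close> or of \<open>x'\<^sup>2\<close>.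
  If neither of \<open>e\<close> and \<open>f\<close> is below the other, they form within the subsemigroup generated
  by \<open>x\<close> and \<open>x'\<close> the complement of \<open>{x, x', e, f}\<close>.\<close>

definition deep :: "'a set" where
  "deep = {u \<in> C. \<exists>p\<in>E. p \<bullet> u = u \<and>
     (below p (x \<bullet> e \<bullet> x') \<or> below p e \<and> below p f \<or> below p (x' \<bullet> f \<bullet> x))}"

lemma deep_swap: "inv_pair.deep m C x' x = deep"
  unfolding inv_pair.deep_def[OF swap] deep_def
  by (intro Collect_cong conj_cong bex_cong refl) blast

lemma conj_E': "p \<in> E \<Longrightarrow> x' \<bullet> p \<bullet> x \<in> E"
  using inv_pair.conj_E[OF swap] .

lemma deep_right: "u \<in> deep \<Longrightarrow> v \<in> C \<Longrightarrow> u \<bullet> v \<in> deep"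
proof -
  assume "u \<in> deep" "v \<in> C"
  then obtain p where "p \<in> E" "p \<bullet> u = u" "u \<bullet> v \<in> C" and
    b: "below p (x \<bullet> e \<bullet> x') \<or> below p e \<and> below p f \<or> below p (x' \<bullet> f \<bullet> x)"
    unfolding deep_def using mult_C by blast
  then have "p \<bullet> (u \<bullet> v) = u \<bullet> v" by (simp flip: assoc)
  then show ?thesis unfolding deep_def using \<open>p \<in> E\<close> \<open>u \<bullet> v \<in> C\<close> b by blast
qed

text \<open>If p fixes u, then x p x' fixes x u, and \<open>below_conj\<close> moves the bounds: x^2
  x'^2 becomes x^3 x'^3, which is below x^2 x'^2; \<open>e\<close> becomes x^2 x'^2; x'^2 x^2
  becomes e f e, which is below \<open>e\<close> and \<open>f\<close>.\<close>

lemma deep_left: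
  assumes "u \<in> deep"
  shows "x \<bullet> u \<in> deep"
proof -
  from assms obtain p where p: "p \<in> E" "p \<bullet> u = u" "u \<in> C" and
    b: "below p (x \<bullet> e \<bullet> x') \<or> below p e \<and> below p f \<or> below p (x' \<bullet> f \<bullet> x)"
    unfolding deep_def by blast
  define P where "P = x \<bullet> p \<bullet> x'"
  have PE: "P \<in> E" unfolding P_def by (rule conj_E[OF p(1)])
  have fp: "f \<bullet> p \<bullet> (f \<bullet> p) = f \<bullet> p" using mult_E[OF fE p(1)] by simp
  have "P \<bullet> (x \<bullet> u) = x \<bullet> p \<bullet> f \<bullet> u" by (simp only: P_def assoc)
  also have "\<dots> = x \<bullet> f \<bullet> p \<bullet> f \<bullet> (p \<bullet> u)" unfolding units p(2) ..
  also have "\<dots> = x \<bullet> (f \<bullet> p \<bullet> (f \<bullet> p)) \<bullet> u" by (simp only: assoc)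
  also have "\<dots> = x \<bullet> f \<bullet> (p \<bullet> u)" unfolding fp by (simp only: assoc)
  also have "\<dots> = x \<bullet> u" unfolding units p(2) ..
  finally have Pu: "P \<bullet> (x \<bullet> u) = x \<bullet> u" .
  have e2: "x \<bullet> e \<bullet> x' \<in> E" by (rule conj_E[OF eE])
  consider "below p (x \<bullet> e \<bullet> x')" | "below p e" | "below p (x' \<bullet> f \<bullet> x)" using b by blast
  then have "below P (x \<bullet> e \<bullet> x') \<or> below P e \<and> below P f"
  proof cases
    case 1
    define e3 where "e3 = x \<bullet> (x \<bullet> e \<bullet> x') \<bullet> x'"
    have e3E: "e3 \<in> E" unfolding e3_def by (intro conj_E eE)
    have "x \<bullet> e \<bullet> x' \<bullet> e3 = e3"
    proof -
      have "x \<bullet> e \<bullet> x' \<bullet> e3 = x \<bullet> e \<bullet> x' \<bullet> (x \<bullet> x) \<bullet> (x \<bullet> x' \<bullet> x' \<bullet> x')"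
        by (simp only: e3_def assoc)
      then show ?thesis unfolding xxx'x'xx by (simp only: e3_def assoc)
    qed
    then have "below e3 (x \<bullet> e \<bullet> x')" unfolding below_def using e3E by (simp add: assoc)
    moreover have "below P e3" unfolding P_def e3_def by (rule below_conj[OF p(1) e2 1])
    ultimately show ?thesis using below_trans[OF PE e3E e2] by blast
  next
    case 2
    then show ?thesis unfolding P_def using below_conj[OF p(1) eE] by blast
  next
    case 3
    have f2: "x' \<bullet> f \<bullet> x \<in> E" by (rule conj_E'[OF fE])
    have efe: "e \<bullet> f \<bullet> e \<in> E" by (intro mult_E eE fE)
    have "x \<bullet> (x' \<bullet> f \<bullet> x) \<bullet> x' = e \<bullet> f \<bullet> e" by (simp only: assoc)
    then have 1: "below P (e \<bullet> f \<bullet> e)" using below_conj[OF p(1) f2 3] by (simp only: P_def)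
    have "e \<bullet> f \<bullet> e = e \<bullet> e \<bullet> (f \<bullet> e)" using eE by (simp add: assoc)
    then have "below (e \<bullet> f \<bullet> e) e"
      by (rule below_mult[OF efe eE]) (intro mult_E eE fE)
    moreover have "below (e \<bullet> f \<bullet> e) f"
      by (rule below_mult[OF efe fE refl]) (intro mult_E eE fE)
    ultimately show ?thesis using below_trans[OF PE efe] eE fE 1 by blast
  qed
  then show ?thesis unfolding deep_def using PE Pu p(3) mult_C xC by blast
qed

lemma deep_left': "u \<in> deep \<Longrightarrow> x' \<bullet> u \<in> deep"
  using inv_pair.deep_left[OF swap] by (simp add: deep_swap)

lemma xx_deep: "x \<bullet> x \<in> deep"
proof -
  have e2: "x \<bullet> e \<bullet> x' \<in> E" by (rule conj_E[OF eE])
  then have "below (x \<bullet> e \<bullet> x') (x \<bullet> e \<bullet> x')" by (simp add: below_def)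
  then show ?thesis unfolding deep_def using e2 xxx'x'xx mult_C xC by blast
qed

lemma x'x'_deep: "x' \<bullet> x' \<in> deep"
  using inv_pair.xx_deep[OF swap] by (simp add: deep_swap)

text \<open>\<open>e\<close> inherits every bound of an idempotent p with p e = e. The bound x^2
  x'^2 gives f e f = f after conjugation by x'; the others give e f e = e.\<close>

lemma e_deep:
  assumes "e \<in> deep"
  shows "f \<bullet> e \<bullet> f = f \<or> e \<bullet> f \<bullet> e = e"
proof -
  from assms obtain p where p: "p \<in> E" "p \<bullet> e = e" and
    b: "below p (x \<bullet> e \<bullet> x') \<or> below p e \<and> below p f \<or> below p (x' \<bullet> f \<bullet> x)"
    unfolding deep_def by blast
  have e_below: "below e r" if "r \<in> E" "below p r" for r
  proof (rule below_mult[OF eE that(1), where u = p and v = e])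
    show "e = p \<bullet> r \<bullet> e" using that(2) p(2) unfolding below_def by (metis assoc)
  qed (intro mult_E eE that)
  have e2: "x \<bullet> e \<bullet> x' \<in> E" by (rule conj_E[OF eE])
  have f2: "x' \<bullet> f \<bullet> x \<in> E" by (rule conj_E'[OF fE])
  consider "below p (x \<bullet> e \<bullet> x')" | "below p f" | "below p (x' \<bullet> f \<bullet> x)" using b by blast
  then show ?thesis
  proof cases
    case 1
    then have q: "e \<bullet> (x \<bullet> e \<bullet> x') \<bullet> e = e" using e_below[OF e2] by (simp add: below_def)
    have "f \<bullet> e \<bullet> f = x' \<bullet> (x \<bullet> e \<bullet> x') \<bullet> x" by (simp only: assoc)
    also have "\<dots> = (x' \<bullet> e) \<bullet> (x \<bullet> e \<bullet> x') \<bullet> (e \<bullet> x)" unfolding units ..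
    also have "\<dots> = x' \<bullet> (e \<bullet> (x \<bullet> e \<bullet> x') \<bullet> e) \<bullet> x" by (simp only: assoc)
    also have "\<dots> = f" unfolding q units ..
    finally show ?thesis ..
  next
    case 2
    then show ?thesis using e_below[OF fE] by (simp add: below_def)
  next
    case 3
    have "below (x' \<bullet> f \<bullet> x) f"
    proof -
      have "(x' \<bullet> f \<bullet> x) \<bullet> f \<bullet> (x' \<bullet> f \<bullet> x) = x' \<bullet> f \<bullet> (x \<bullet> f) \<bullet> (x' \<bullet> f \<bullet> x)" by (simp only: assoc)
      then show ?thesis unfolding below_def units using f2 by simp
    qed
    then have "below e f" using below_trans[OF eE f2 fE e_below[OF f2 3]] by blast
    then show ?thesis by (simp add: below_def)
  qed
qed

lemma gen_subset: "gen m {x, x'} \<subseteq> deep \<union> {x, x', e, f}"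
proof -
  define W where "W = deep \<union> {x, x', e, f}"
  have a: "x \<bullet> v \<in> W" if "v \<in> W" for v
  proof -
    have "x \<bullet> e \<in> deep" using deep_right[OF xx_deep xC(2)] by (simp add: assoc)
    then show ?thesis using that deep_left xx_deep units unfolding W_def by auto
  qed
  have b: "x' \<bullet> v \<in> W" if "v \<in> W" for v
  proof -
    have "x' \<bullet> f \<in> deep" using deep_right[OF x'x'_deep xC(1)] by (simp add: assoc)
    then show ?thesis using that deep_left' x'x'_deep units unfolding W_def by auto
  qed
  have "gen m {x, x'} \<subseteq> {u \<in> W. \<forall>v\<in>W. u \<bullet> v \<in> W}"
  proof (rule gen_least)
    show "{x, x'} \<subseteq> {u \<in> W. \<forall>v\<in>W. u \<bullet> v \<in> W}" using a b by (simp add: W_def)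
    have "a \<bullet> b \<in> W \<and> (\<forall>v\<in>W. a \<bullet> b \<bullet> v \<in> W)"
      if a: "\<forall>v\<in>W. a \<bullet> v \<in> W" and b: "b \<in> W" "\<forall>v\<in>W. b \<bullet> v \<in> W" for a b
    proof (intro conjI ballI)
      show "a \<bullet> b \<in> W" by (rule bspec[OF a b(1)])
      fix v assume "v \<in> W"
      show "a \<bullet> b \<bullet> v \<in> W"
        unfolding assoc by (rule bspec[OF a bspec[OF b(2) \<open>v \<in> W\<close>]])
    qed
    then show "mclosed m {u \<in> W. \<forall>v\<in>W. u \<bullet> v \<in> W}"
      unfolding mclosed_def by simp
  qed
  then show ?thesis unfolding W_def by blast
qed

lemma deep_ideal:
  assumes "u \<in> gen m {x, x'}" "v \<in> deep"
  shows "u \<bullet> v \<in> deep \<and> v \<bullet> u \<in> deep"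
  using assms
proof (induction arbitrary: v)
  case (gen_base a)
  then show ?case using deep_left deep_left' deep_right xC by blast
next
  case (gen_mult a b)
  then have "a \<bullet> (b \<bullet> v) \<in> deep" "v \<bullet> a \<bullet> b \<in> deep" by blast+
  then show ?case by (simp add: assoc)
qed

end

section \<open>Regularity of the image\<close>

context sbij
begin

text \<open>An idempotent is its own inverse. If \<open>e\<close> and \<open>f\<close> are
  incomparable, \<open>deep\<close> meets the subsemigroup generated by x and x' in an ideal with
  complement {x, x', e, f}, as \<open>square_case\<close> requires.\<close>

lemma regular_image:
  assumes idem_closed: "mclosed m {p \<in> C. p \<bullet> p = p}"
    and C: "x \<in> C" "x' \<in> C"
    and x: "x \<bullet> x' \<bullet> x = x" "x' \<bullet> x \<bullet> x' = x'"
  shows "\<exists>s\<in>\<phi> ` C. \<phi> x \<star> s \<star> \<phi> x = \<phi> x"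
proof -
  interpret inv_pair m C x x'
    using C_closed idem_closed C x by unfold_locales
  consider "x \<bullet> x = x" | "x \<bullet> x \<noteq> x" "f \<bullet> e \<bullet> f = f" | "x \<bullet> x \<noteq> x" "e \<bullet> f \<bullet> e = e"
    | "x \<bullet> x \<noteq> x" "f \<bullet> e \<bullet> f \<noteq> f" "e \<bullet> f \<bullet> e \<noteq> e" by blast
  then show ?thesis
  proof cases
    case 1
    then have "\<phi> x \<star> \<phi> x \<star> \<phi> x = \<phi> x" using idem_iff[OF C(1)] by simp
    then show ?thesis using C by blast
  next
    case 2
    then show ?thesis using comparable_case[OF idem_closed C _ x refl refl] by blast
  next
    case 3
    then show ?thesis using comparable_case'[OF idem_closed C _ x refl refl] by blast
  next
    case 4
    have eK: "e \<notin> deep" using e_deep 4 by blast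
    \<comment> \<open>\<open>deep\<close> absorbs multiplication by x and x', and each of these
      elements can be multiplied back to \<open>e\<close>.\<close>
    then have xK: "x \<notin> deep" "x' \<notin> deep" using deep_right deep_left C by blast+
    then have fK: "f \<notin> deep" using deep_left[of f] units by auto
    have W: "{x, x', e, f} \<subseteq> gen m {x, x'}"
      using gen_mult[of x m "{x, x'}" x'] gen_mult[of x' m "{x, x'}" x] by (simp add: gen_base)
    define I where "I = deep \<inter> gen m {x, x'}"
    have gen: "gen m {x, x'} = I \<union> {x, x', e, f}"
      unfolding I_def using gen_subset W by blast
    have prods: "x \<bullet> x \<in> deep" "x' \<bullet> x' \<in> deep" by (fact xx_deep x'x'_deep)+
    then have prods': "x \<bullet> e \<in> deep" "f \<bullet> x \<in> deep" "x' \<bullet> f \<in> deep" "e \<bullet> x' \<in> deep"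
      using deep_right[OF prods(1) C(2)] deep_right[OF prods(2) C(1)]
        deep_left[OF prods(2)] deep_left'[OF prods(1)] by (simp_all add: S.assoc)
    have U: "a \<bullet> b \<in> gen m {x, x'}" if "a \<in> {x, x', e, f}" "b \<in> {x, x', e, f}" for a b
      using that W by (intro gen.gen_mult) (rule subsetD[OF W], assumption)+
    show ?thesis
    proof (rule square_case[OF C refl refl units gen])
      \<comment> \<open>A coincidence would make \<open>e\<close> and \<open>f\<close> comparable or
        x idempotent, or would put \<open>e\<close> or \<open>f\<close> into \<open>deep\<close> as
        a square of x or x'.\<close>
      have ef: "e \<bullet> e = e" "f \<bullet> f = f" using eE fE by blast+
      then show "e \<noteq> f" using 4 by metis
      show "x \<noteq> e" "x \<noteq> f" using 4 ef by metis+
      show "x \<noteq> x'" using prods(1) eK by metis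
      show "x' \<noteq> e" "x' \<noteq> f" using prods(2) eK fK ef by metis+
      show "u \<bullet> i \<in> I \<and> i \<bullet> u \<in> I" if "u \<in> I \<union> {x, x', e, f}" "i \<in> I" for u i
      proof -
        have u: "u \<in> gen m {x, x'}" unfolding gen by (rule that(1))
        have i: "i \<in> deep" "i \<in> gen m {x, x'}" using that(2) by (auto simp: I_def)
        show ?thesis using deep_ideal[OF u i(1)] gen.gen_mult[OF u i(2)] gen.gen_mult[OF i(2) u]
          by (simp add: I_def)
      qed
      show "x \<notin> I" "x' \<notin> I" "e \<notin> I" "f \<notin> I" using eK xK fK unfolding I_def by blast+
      show "x \<bullet> x \<in> I" "x' \<bullet> x' \<in> I" "x \<bullet> e \<in> I" "f \<bullet> x \<in> I" "x' \<bullet> f \<in> I" "e \<bullet> x' \<in> I"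
        unfolding I_def by (simp_all add: prods prods' U del: IntE)
    qed
  qed
qed

end

section \<open>Isomorphisms of subsemigroup lattices\<close>

locale sub_iso = S: sgp m + T: sgp n
  for m :: "'a \<Rightarrow> 'a \<Rightarrow> 'a"  (infixl "\<bullet>" 70)
  and n :: "'b \<Rightarrow> 'b \<Rightarrow> 'b"  (infixl "\<star>" 70) +
  fixes C :: "'a set" and D :: "'b set" and \<Phi> :: "'a set \<Rightarrow> 'b set"
  assumes C_closed: "mclosed m C" and D_closed: "mclosed n D"
    and bij: "bij_betw \<Phi> {A. A \<subseteq> C \<and> mclosed m A} {B. B \<subseteq> D \<and> mclosed n B}"
    and order: "A \<subseteq> C \<Longrightarrow> mclosed m A \<Longrightarrow> A' \<subseteq> C \<Longrightarrow> mclosed m A' \<Longrightarrow> A \<subseteq> A' \<longleftrightarrow> \<Phi> A \<subseteq> \<Phi> A'"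
begin

abbreviation "L \<equiv> {A. A \<subseteq> C \<and> mclosed m A}"
abbreviation "M \<equiv> {B. B \<subseteq> D \<and> mclosed n B}"

definition \<Psi> :: "'b set \<Rightarrow> 'a set" where "\<Psi> = inv_into L \<Phi>"

lemma \<Phi>_M: "A \<in> L \<Longrightarrow> \<Phi> A \<in> M"
  using bij by (rule bij_betw_apply)

lemma \<Psi>_L: "B \<in> M \<Longrightarrow> \<Psi> B \<in> L"
  unfolding \<Psi>_def by (rule bij_betw_apply[OF bij_betw_inv_into[OF bij]])

lemma \<Phi>\<Psi>: "B \<in> M \<Longrightarrow> \<Phi> (\<Psi> B) = B"
  unfolding \<Psi>_def by (rule bij_betw_inv_into_right[OF bij])

lemma \<Psi>\<Phi>: "A \<in> L \<Longrightarrow> \<Psi> (\<Phi> A) = A"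
  unfolding \<Psi>_def by (rule bij_betw_inv_into_left[OF bij])

lemma \<Phi>_mono_iff:
  assumes "A \<in> L" "A' \<in> L"
  shows "\<Phi> A \<subseteq> \<Phi> A' \<longleftrightarrow> A \<subseteq> A'"
proof -
  have "A \<subseteq> C" "mclosed m A" "A' \<subseteq> C" "mclosed m A'" using assms by blast+
  then show ?thesis by (rule order[symmetric])
qed

lemma \<Psi>_mono_iff:
  assumes "B \<in> M" "B' \<in> M"
  shows "\<Psi> B \<subseteq> \<Psi> B' \<longleftrightarrow> B \<subseteq> B'"
  using \<Phi>_mono_iff[OF \<Psi>_L[OF assms(1)] \<Psi>_L[OF assms(2)]]
  unfolding \<Phi>\<Psi>[OF assms(1)] \<Phi>\<Psi>[OF assms(2)] by (rule sym)

text \<open>This symmetry lets results about images under \<open>\<Phi>\<close> be used for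
  preimages.\<close>

lemma inverse: "sub_iso n m D C \<Psi>"
proof unfold_locales
  show "bij_betw \<Psi> M L" unfolding \<Psi>_def by (rule bij_betw_inv_into[OF bij])
  show "A \<subseteq> A' \<longleftrightarrow> \<Psi> A \<subseteq> \<Psi> A'"
    if "A \<subseteq> D" "mclosed n A" "A' \<subseteq> D" "mclosed n A'" for A A'
    using \<Psi>_mono_iff[of A A'] that by simp
qed (fact D_closed C_closed)+

lemma \<Phi>_empty: "\<Phi> {} = {}"
proof -
  have e: "{} \<in> L" "{} \<in> M" by (auto simp: mclosed_def)
  then have "\<Phi> {} \<subseteq> \<Phi> (\<Psi> {})" using \<Phi>_mono_iff \<Psi>_L by blast
  then show ?thesis using \<Phi>\<Psi>[OF e(2)] by simp
qed

lemma cyc_L: "x \<in> C \<Longrightarrow> cyc m x \<in> L"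
  using S.cyc_least[OF C_closed] S.mclosed_cyc by simp

lemma cyc_M: "x \<in> D \<Longrightarrow> cyc n x \<in> M"
  using T.cyc_least[OF D_closed] T.mclosed_cyc by simp

text \<open>{e} is an atom, so each element z of its image generates the whole image. In particular
  z is a power of z^2, hence has finite order, and an idempotent power of z generates a
  singleton.\<close>

lemma idem_image:
  assumes "e \<in> C" "e \<bullet> e = e"
  obtains e' where "e' \<in> D" "e' \<star> e' = e'" "\<Phi> {e} = {e'}"
proof -
  have e: "{e} \<in> L" and empty: "{} \<in> L" using assms by (auto simp: mclosed_def)
  have "\<Phi> {e} \<noteq> {}" using \<Psi>\<Phi>[OF e] \<Psi>\<Phi>[OF empty] \<Phi>_empty by auto
  then obtain z where z: "z \<in> \<Phi> {e}" by blast
  have zD: "z \<in> D" "mclosed n (\<Phi> {e})" using z \<Phi>_M[OF e] by auto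
  have minimal: "B = \<Phi> {e}" if B: "B \<in> M" "B \<subseteq> \<Phi> {e}" "B \<noteq> {}" for B
  proof -
    have "\<Psi> B \<subseteq> {e}" using \<Psi>_mono_iff[OF B(1) \<Phi>_M[OF e]] B(2) \<Psi>\<Phi>[OF e] by simp
    moreover have "\<Psi> B \<noteq> {}" using \<Phi>\<Psi>[OF B(1)] B(3) \<Phi>_empty by auto
    ultimately have "\<Psi> B = {e}" by blast
    then show ?thesis using \<Phi>\<Psi>[OF B(1)] by simp
  qed
  have sub: "cyc n u = \<Phi> {e}" if "u \<in> \<Phi> {e}" for u
    using minimal[OF cyc_M[of u]] T.cyc_least[OF zD(2) that] T.cyc_self[of u] that \<Phi>_M[OF e] by blast
  have "z \<star> z \<in> \<Phi> {e}" using mclosedD[OF zD(2)] z by blast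
  then have "z \<in> cyc n (z \<star> z)" using sub z by metis
  then obtain k where "pw n z 0 = pw n (pw n z 1) k" by (auto simp: cyc_def)
  then have "pw n z 0 = pw n z (1 + k + 1 * k)" by (simp only: T.pw_pw)
  then have "\<not> inj (pw n z)" by (metis add_is_0 injD one_neq_zero)
  then obtain e' where e': "e' \<in> cyc n z" "e' \<star> e' = e'" by (rule T.idem_in_cyc)
  then have "e' \<in> \<Phi> {e}" using sub[OF z] by simp
  then show thesis using that sub T.idem_cyc e'(2) \<Phi>_M[OF e] by blast
qed

text \<open>An idempotent in the image pulls back to an idempotent singleton inside
  \<open>A\<close>.\<close>

lemma idem_free_image:
  assumes "A \<in> L" "\<And>a. a \<in> A \<Longrightarrow> a \<bullet> a \<noteq> a" "b \<in> \<Phi> A"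
  shows "b \<star> b \<noteq> b"
proof
  assume bb: "b \<star> b = b"
  have bD: "b \<in> D" using \<Phi>_M[OF assms(1)] assms(3) by blast
  obtain a where a: "a \<in> C" "a \<bullet> a = a" "\<Psi> {b} = {a}"
    using sub_iso.idem_image[OF inverse bD bb] .
  have "{b} \<in> M" using bD bb by (simp add: mclosed_def)
  then have "\<Psi> {b} \<subseteq> A"
    using \<Psi>_mono_iff[of "{b}" "\<Phi> A"] \<Phi>_M[OF assms(1)] \<Psi>\<Phi>[OF assms(1)] assms(3) by simp
  then show False using assms(2) a by simp
qed

text \<open>The powers with exponent at least 2 form the greatest proper closed subset
  \<open>N\<close> of \<open>cyc m x\<close>, so any y in the image of \<open>cyc m x\<close> but
  not in that of \<open>N\<close> generates the whole image.\<close>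

lemma cyc_image:
  assumes x: "x \<in> C" and inj: "inj (pw m x)"
  obtains y where "y \<in> D" "inj (pw n y)" "\<Phi> (cyc m x) = cyc n y"
proof -
  define N where "N = {pw m x (Suc k) |k. True}"
  have cL: "cyc m x \<in> L" by (rule cyc_L[OF x])
  have Nc: "N \<subseteq> cyc m x" unfolding N_def cyc_def by blast
  have NL: "N \<in> L"
  proof -
    have "mclosed m N" unfolding mclosed_def N_def
      by (clarsimp simp del: pw.simps) (metis S.pw_add add_Suc add_Suc_right)
    then show ?thesis using Nc cL by blast
  qed
  have xN: "x \<notin> N"
  proof
    assume "x \<in> N"
    then obtain k where "pw m x 0 = pw m x (Suc k)" by (auto simp: N_def)
    then have "0 = Suc k" by (rule injD[OF inj])
    then show False by simp
  qed
  have "\<not> \<Phi> (cyc m x) \<subseteq> \<Phi> N"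
    using \<Phi>_mono_iff[OF cL NL] xN S.cyc_self[of x] by blast
  then obtain y where y: "y \<in> \<Phi> (cyc m x)" "y \<notin> \<Phi> N" by blast
  have yD: "y \<in> D" and cl: "mclosed n (\<Phi> (cyc m x))" using y \<Phi>_M[OF cL] by auto
  have yc: "cyc n y \<subseteq> \<Phi> (cyc m x)" using T.cyc_least[OF cl y(1)] .
  have yM: "cyc n y \<in> M" by (rule cyc_M[OF yD])
  have A: "\<Psi> (cyc n y) \<subseteq> cyc m x"
    using \<Psi>_mono_iff[OF yM \<Phi>_M[OF cL]] yc \<Psi>\<Phi>[OF cL] by simp
  have "x \<in> \<Psi> (cyc n y)"
  proof (rule ccontr)
    assume nx: "x \<notin> \<Psi> (cyc n y)"
    have "\<Psi> (cyc n y) \<subseteq> N"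
    proof
      fix a assume a: "a \<in> \<Psi> (cyc n y)"
      then obtain k where k: "a = pw m x k" using A by (auto simp: cyc_def)
      then show "a \<in> N" using a nx by (cases k) (auto simp: N_def simp del: pw.simps(2))
    qed
    then have "cyc n y \<subseteq> \<Phi> N" using \<Phi>_mono_iff[OF \<Psi>_L[OF yM] NL] \<Phi>\<Psi>[OF yM] by simp
    then show False using y(2) T.cyc_self by blast
  qed
  then have "cyc m x \<subseteq> \<Psi> (cyc n y)" using \<Psi>_L[OF yM] S.cyc_least by blast
  then have eq: "\<Phi> (cyc m x) = cyc n y" using A \<Phi>\<Psi>[OF yM] by auto
  have "inj (pw n y)"
  proof (rule ccontr)
    assume "\<not> inj (pw n y)"
    then obtain e where "e \<in> cyc n y" "e \<star> e = e" by (rule T.idem_in_cyc)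
    then show False using idem_free_image[OF cL S.inj_pw_not_idem[OF inj]] eq by metis
  qed
  then show thesis using that yD eq by blast
qed

end

section \<open>The bijection of elements induced by a lattice isomorphism\<close>

locale tf_sub_iso = sub_iso +
  assumes S_tf: "x \<in> C \<Longrightarrow> x \<bullet> x \<noteq> x \<Longrightarrow> inj (pw m x)"
begin

text \<open>For \<open>t\<close> of finite order, \<open>cyc n t\<close> has no element of infinite
  order and just one idempotent. Its preimage is then a single idempotent, which makes
  \<open>t\<close> idempotent.\<close>

lemma T_tf:
  assumes t: "t \<in> D" "t \<star> t \<noteq> t"
  shows "inj (pw n t)"
proof (rule ccontr)
  assume ninj: "\<not> inj (pw n t)"
  define A where "A = \<Psi> (cyc n t)"
  have tM: "cyc n t \<in> M" by (rule cyc_M[OF t(1)])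
  have AL: "A \<in> L" and \<Phi>A: "\<Phi> A = cyc n t" unfolding A_def by (rule \<Psi>_L[OF tM] \<Phi>\<Psi>[OF tM])+
  have idem: "z \<bullet> z = z" if "z \<in> A" for z
  proof (rule ccontr)
    assume "z \<bullet> z \<noteq> z"
    have zC: "z \<in> C" using that AL by blast
    obtain y where y: "inj (pw n y)" "\<Phi> (cyc m z) = cyc n y"
      using cyc_image[OF zC S_tf[OF zC \<open>z \<bullet> z \<noteq> z\<close>]] by blast
    have "cyc m z \<subseteq> A" using S.cyc_least that AL by blast
    then have "cyc n y \<subseteq> cyc n t" using \<Phi>_mono_iff[OF cyc_L[OF zC] AL] y \<Phi>A by simp
    then obtain k where "y = pw n t k" using T.cyc_self[of y] by (auto simp: cyc_def)
    then show False using T.finite_order_pw[OF ninj] y(1) by blast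
  qed
  have idem_im: "\<exists>e'. \<Phi> {z} = {e'} \<and> e' \<in> cyc n t \<and> e' \<star> e' = e'" if zA: "z \<in> A" for z
  proof -
    have "z \<in> C" using zA AL by blast
    then obtain e' where e': "e' \<star> e' = e'" "\<Phi> {z} = {e'}"
      by (rule idem_image[OF _ idem[OF zA]])
    moreover have "{z} \<in> L" using idem[OF zA] zA AL by (auto simp: mclosed_def)
    then have "\<Phi> {z} \<subseteq> \<Phi> A" using \<Phi>_mono_iff AL zA by blast
    ultimately show ?thesis using \<Phi>A by auto
  qed
  have "A \<noteq> {}" using \<Phi>A \<Phi>_empty T.cyc_self[of t] by auto
  then obtain z where z: "z \<in> A" by blast
  have "A = {z}"
  proof -
    have "u = z" if u: "u \<in> A" for u
    proof -
      obtain a b where "\<Phi> {u} = {a}" "\<Phi> {z} = {b}" "a \<in> cyc n t" "b \<in> cyc n t"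
        "a \<star> a = a" "b \<star> b = b"
        using idem_im[OF u] idem_im[OF z] by blast
      then have "\<Phi> {u} = \<Phi> {z}" using T.idem_cyc_unique by blast
      moreover have "{u} \<in> L" "{z} \<in> L" using idem u z AL by (auto simp: mclosed_def)
      ultimately have "{u} = {z}" using \<Psi>\<Phi> by metis
      then show ?thesis by simp
    qed
    then show ?thesis using z by blast
  qed
  then obtain e' where "cyc n t = {e'}" "e' \<star> e' = e'" using idem_im[OF z] \<Phi>A by auto
  then show False using T.cyc_self[of t] t(2) by simp
qed

lemma cyc_D_eq:
  assumes "y \<in> D" "cyc n y = cyc n z"
  shows "y = z"
proof (cases "y \<star> y = y")
  case True
  then have "cyc n z = {y}" using T.idem_cyc assms(2) by metis
  then show ?thesis using T.cyc_self[of z] by simp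
next
  case False
  then show ?thesis using T.cyc_eq_imp_eq[OF T_tf[OF assms(1)]] assms(2) by blast
qed

lemma cyc_image_ex1:
  assumes "x \<in> C"
  shows "\<exists>!y. y \<in> D \<and> \<Phi> (cyc m x) = cyc n y"
proof -
  have "\<exists>y. y \<in> D \<and> \<Phi> (cyc m x) = cyc n y"
  proof (cases "x \<bullet> x = x")
    case True
    then obtain e' where "e' \<in> D" "e' \<star> e' = e'" "\<Phi> {x} = {e'}" using idem_image assms by blast
    then show ?thesis using True S.idem_cyc T.idem_cyc by metis
  next
    case False
    then show ?thesis using cyc_image[OF assms S_tf[OF assms]] by blast
  qed
  then show ?thesis using cyc_D_eq by metis
qed

definition \<phi> :: "'a \<Rightarrow> 'b" where
  "\<phi> x = (THE y. y \<in> D \<and> \<Phi> (cyc m x) = cyc n y)"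

lemma \<phi>: "x \<in> C \<Longrightarrow> \<phi> x \<in> D \<and> \<Phi> (cyc m x) = cyc n (\<phi> x)"
  unfolding \<phi>_def by (rule theI'[OF cyc_image_ex1])

lemma \<phi>_preimage:
  assumes t: "t \<in> D"
  obtains x where "x \<in> C" "\<phi> x = t" "\<Psi> (cyc n t) = cyc m x"
proof -
  have "\<exists>x. x \<in> C \<and> \<Psi> (cyc n t) = cyc m x"
  proof (cases "t \<star> t = t")
    case True
    then obtain e where "e \<in> C" "e \<bullet> e = e" "\<Psi> {t} = {e}"
      using sub_iso.idem_image[OF inverse t] by blast
    then show ?thesis using True S.idem_cyc T.idem_cyc by metis
  next
    case False
    then show ?thesis using sub_iso.cyc_image[OF inverse t T_tf[OF t]] by blast
  qed
  then obtain x where x: "x \<in> C" "\<Psi> (cyc n t) = cyc m x" by blast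
  then have "\<Phi> (cyc m x) = cyc n t" using \<Phi>\<Psi>[OF cyc_M[OF t]] by simp
  then have "\<phi> x = t" using \<phi>[OF x(1)] cyc_D_eq[of "\<phi> x" t] by simp
  then show thesis using that x by blast
qed

text \<open>A closed set is the union of the cyclic sets it contains, and \<open>\<Phi>\<close>
  matches these with the cyclic sets contained in the image.\<close>

lemma \<Phi>_eq_image:
  assumes "A \<in> L"
  shows "\<Phi> A = \<phi> ` A"
proof (rule subset_antisym)
  show "\<phi> ` A \<subseteq> \<Phi> A"
  proof
    fix t assume "t \<in> \<phi> ` A"
    then obtain x where x: "x \<in> A" "t = \<phi> x" by blast
    then have xC: "x \<in> C" using assms by blast
    have "cyc m x \<subseteq> A" using S.cyc_least x assms by blast
    then have "cyc n (\<phi> x) \<subseteq> \<Phi> A"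
      using \<Phi>_mono_iff[OF cyc_L[OF xC] assms] \<phi>[OF xC] by simp
    then show "t \<in> \<Phi> A" using T.cyc_self x by blast
  qed
  show "\<Phi> A \<subseteq> \<phi> ` A"
  proof
    fix t assume t: "t \<in> \<Phi> A"
    then have tD: "t \<in> D" and cl: "mclosed n (\<Phi> A)" using \<Phi>_M[OF assms] by auto
    obtain x where x: "\<phi> x = t" "\<Psi> (cyc n t) = cyc m x" using \<phi>_preimage[OF tD] .
    have "\<Psi> (cyc n t) \<subseteq> A"
      using \<Psi>_mono_iff[OF cyc_M[OF tD] \<Phi>_M[OF assms]] T.cyc_least[OF cl t] \<Psi>\<Phi>[OF assms] by simp
    then have "x \<in> A" using x S.cyc_self by auto
    then show "t \<in> \<phi> ` A" using x by blast
  qed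
qed

lemma \<phi>_inj: "inj_on \<phi> C"
proof (rule inj_onI)
  fix a b assume ab: "a \<in> C" "b \<in> C" "\<phi> a = \<phi> b"
  then have "\<Phi> (cyc m a) = \<Phi> (cyc m b)" using \<phi> by metis
  then have cyc: "cyc m a = cyc m b" using \<Psi>\<Phi> cyc_L ab by metis
  show "a = b"
  proof (cases "a \<bullet> a = a")
    case True
    then have "cyc m b = {a}" using S.idem_cyc cyc by metis
    then show ?thesis using S.cyc_self[of b] by simp
  next
    case False
    then show ?thesis using S.cyc_eq_imp_eq[OF S_tf] ab cyc by blast
  qed
qed

lemma \<phi>_surj: "\<phi> ` C = D"
  using \<phi> \<phi>_preimage by blast

text \<open>For reflection, a closed image of \<open>A\<close> is \<open>\<Phi> B\<close> for a
  closed \<open>B\<close>, hence the image of \<open>B\<close> under \<open>\<phi>\<close>, and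
  injectivity gives B = A.\<close>

sublocale sbij m n \<phi> C
proof unfold_locales
  fix A assume A: "A \<subseteq> C"
  show "mclosed n (\<phi> ` A) \<longleftrightarrow> mclosed m A"
  proof
    assume "mclosed m A"
    then have "A \<in> L" using A by blast
    then show "mclosed n (\<phi> ` A)" using \<Phi>_eq_image \<Phi>_M by fastforce
  next
    assume "mclosed n (\<phi> ` A)"
    then have M: "\<phi> ` A \<in> M" using A \<phi> by blast
    then have "\<phi> ` \<Psi> (\<phi> ` A) = \<phi> ` A" using \<Phi>_eq_image[OF \<Psi>_L[OF M]] \<Phi>\<Psi>[OF M] by simp
    then have "\<Psi> (\<phi> ` A) = A" using inj_on_image_eq_iff[OF \<phi>_inj] A \<Psi>_L[OF M] by blast
    then show "mclosed m A" using \<Psi>_L[OF M] by simp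
  qed
next
  fix x assume x: "x \<in> C" "x \<bullet> x \<noteq> x"
  then obtain y where y: "inj (pw n y)" "\<Phi> (cyc m x) = cyc n y" "y \<in> D"
    using cyc_image[OF x(1) S_tf[OF x]] by blast
  then have "\<phi> x = y" using \<phi>[OF x(1)] cyc_D_eq by metis
  then show "inj (pw n (\<phi> x))" using y by simp
qed (fact \<phi>_inj C_closed S_tf)+

theorem orthodox_image:
  assumes idem: "mclosed m {p \<in> C. p \<bullet> p = p}"
    and reg: "\<And>x. x \<in> C \<Longrightarrow> \<exists>x'\<in>C. x \<bullet> x' \<bullet> x = x"
  shows "mclosed n {q \<in> D. q \<star> q = q}" "t \<in> D \<Longrightarrow> \<exists>s\<in>D. t \<star> s \<star> t = t"
proof -
  have "{q \<in> D. q \<star> q = q} = \<phi> ` {p \<in> C. p \<bullet> p = p}"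
  proof (intro subset_antisym subsetI)
    fix q assume q: "q \<in> {q \<in> D. q \<star> q = q}"
    then obtain p where p: "p \<in> C" "q = \<phi> p" using \<phi>_preimage[of q] by blast
    then show "q \<in> \<phi> ` {p \<in> C. p \<bullet> p = p}" using q idem_iff[OF p(1)] by simp
  next
    fix q assume "q \<in> \<phi> ` {p \<in> C. p \<bullet> p = p}"
    then obtain p where p: "p \<in> C" "p \<bullet> p = p" "q = \<phi> p" by blast
    then show "q \<in> {q \<in> D. q \<star> q = q}" using idem_iff[OF p(1)] \<phi>[OF p(1)] by simp
  qed
  moreover have "mclosed n (\<phi> ` {p \<in> C. p \<bullet> p = p})" using sub_iff[of "{p \<in> C. p \<bullet> p = p}"] idem by simp
  ultimately show "mclosed n {q \<in> D. q \<star> q = q}" by simp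
  assume "t \<in> D"
  then obtain x where x: "x \<in> C" "t = \<phi> x" using \<phi>_preimage by metis
  then obtain z where z: "z \<in> C" "x \<bullet> z \<bullet> x = x" using reg by blast
  \<comment> \<open>Passing from z to z x z makes the pair mutually inverse.\<close>
  have "z \<bullet> x \<bullet> z \<in> C" using z x mult_C by blast
  moreover have "x \<bullet> (z \<bullet> x \<bullet> z) \<bullet> x = x" using z(2) by (metis S.assoc)
  moreover have "z \<bullet> x \<bullet> z \<bullet> x \<bullet> (z \<bullet> x \<bullet> z) = z \<bullet> x \<bullet> z" using z(2) by (metis S.assoc)
  ultimately have "\<exists>s\<in>\<phi> ` C. \<phi> x \<star> s \<star> \<phi> x = \<phi> x" by (rule regular_image[OF idem x(1)])
  then show "\<exists>s\<in>D. t \<star> s \<star> t = t" unfolding x(2) \<phi>_surj .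
qed

end

section \<open>Torsion-free orthodox semigroups\<close>

text \<open>With \<open>None\<close> as an adjoined zero the operation becomes associative on the whole type.\<close>

definition total_mul :: "'a sgrp \<Rightarrow> 'a option \<Rightarrow> 'a option \<Rightarrow> 'a option" where
  "total_mul S a b = (case (a, b) of
     (Some x, Some y) \<Rightarrow> if x \<in> carrier S \<and> y \<in> carrier S then Some (x \<cdot>\<^bsub>S\<^esub> y) else None
   | _ \<Rightarrow> None)"

lemma total_mul_Some:
  "x \<in> carrier S \<Longrightarrow> y \<in> carrier S \<Longrightarrow> total_mul S (Some x) (Some y) = Some (x \<cdot>\<^bsub>S\<^esub> y)"
  by (simp add: total_mul_def)

lemma (in semigrp) sgp_total_mul: "sgp (total_mul S)"
proof
  show "total_mul S (total_mul S a b) c = total_mul S a (total_mul S b c)" for a b c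
    by (cases a; cases b; cases c) (auto simp: total_mul_def smul_closed smul_assoc)
qed

lemma (in semigrp) pw_total_mul:
  assumes "x \<in> carrier S"
  shows "pw (total_mul S) (Some x) k = Some (spow_Suc S x k)"
proof -
  have "spow_Suc S x k \<in> carrier S" for k
    by (induction k) (simp_all add: assms smul_closed)
  then show ?thesis
    by (induction k) (simp_all add: total_mul_Some assms)
qed

lemma mclosed_total_mul:
  "A \<subseteq> carrier S \<Longrightarrow> mclosed (total_mul S) (Some ` A) \<longleftrightarrow> subsemigrp A S"
  by (auto simp: mclosed_def subsemigrp_def total_mul_def subset_iff)

text \<open>Once two powers with indices i < j agree, any index can be lowered until it is below
  j.\<close>

lemma (in sgp) finite_cyc:
  assumes "\<not> inj (pw m z)"
  shows "finite (cyc m z)"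
proof -
  obtain i j where ij: "i < j" "pw m z i = pw m z j"
    using assms unfolding inj_def by (metis nat_neq_iff)
  have "pw m z k \<in> pw m z ` {..<j}" for k
  proof (induction k rule: less_induct)
    case (less k)
    show ?case
    proof (cases "k < j")
      case False
      then obtain d where d: "k = j + d" by (metis le_add_diff_inverse not_less)
      have "pw m z (j + d) = pw m z (i + d)" by (induction d) (simp_all add: ij(2))
      then show ?thesis using less.IH[of "i + d"] ij(1) d by simp
    qed simp
  qed
  then have "cyc m z \<subseteq> pw m z ` {..<j}" unfolding cyc_def by blast
  then show ?thesis using finite_surj by blast
qed

lemma (in semigrp) infinite_order_iff_inj:
  assumes "x \<in> carrier S"
  shows "infinite_order S x \<longleftrightarrow> inj (pw (total_mul S) (Some x))"
proof -
  interpret sgp "total_mul S" by (rule sgp_total_mul)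
  have eq: "cyc (total_mul S) (Some x) = Some ` cyclic_sub S x"
    by (simp add: cyc_def cyclic_sub_def pw_total_mul[OF assms] image_image)
  have "finite (cyclic_sub S x) \<longleftrightarrow> finite (cyc (total_mul S) (Some x))"
    unfolding eq by (simp add: finite_image_iff)
  moreover have "infinite (cyc (total_mul S) (Some x))" if "inj (pw (total_mul S) (Some x))"
    unfolding cyc_def using finite_imageD[OF _ that] by blast
  ultimately show ?thesis unfolding infinite_order_def using finite_cyc by blast
qed

lemma idempotents_total_mul:
  "{p \<in> Some ` carrier S. total_mul S p p = p} = Some ` idempotents S"
  by (auto simp: idempotents_def total_mul_Some)

lemma closed_subsets_total_mul:
  "{A. A \<subseteq> Some ` carrier R \<and> mclosed (total_mul R) A} = (`) Some ` {A. subsemigrp A R}"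
proof (intro subset_antisym subsetI)
  fix A assume A: "A \<in> {A. A \<subseteq> Some ` carrier R \<and> mclosed (total_mul R) A}"
  then obtain B where "B \<subseteq> carrier R" "A = Some ` B" by (auto elim: subset_imageE)
  then show "A \<in> (`) Some ` {A. subsemigrp A R}" using A mclosed_total_mul by blast
next
  fix A assume "A \<in> (`) Some ` {A. subsemigrp A R}"
  then obtain B where B: "subsemigrp B R" "A = Some ` B" by blast
  then have "B \<subseteq> carrier R" by (simp add: subsemigrp_def)
  then show "A \<in> {A. A \<subseteq> Some ` carrier R \<and> mclosed (total_mul R) A}"
    using B mclosed_total_mul by blast
qed

lemma torsion_free_orthodox_image:
  fixes S :: "'a sgrp" and T :: "'b sgrp"
  assumes tfo: "torsion_free_orthodox S" and T: "semigrp T" and iso: "lattice_isomorphism S T \<Phi>"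
  shows "torsion_free_orthodox T"
proof -
  let ?m = "total_mul S" and ?n = "total_mul T"
  let ?C = "Some ` carrier S" and ?D = "Some ` carrier T"
  \<comment> \<open>\<open>\<Phi>\<close> transported along the embedding
    \<open>Some\<close>.\<close>
  define \<Phi>' where "\<Phi>' A = Some ` \<Phi> (Some -` A)" for A
  have tf: "torsion_free S" and reg: "regular_semigrp S" and idem: "subsemigrp (idempotents S) S"
    using tfo by (auto simp: torsion_free_orthodox_def orthodox_semigrp_def)
  interpret S: semigrp S using tf by (simp add: torsion_free_def)
  interpret T: semigrp T by fact
  have bij: "bij_betw \<Phi> {A. subsemigrp A S} {B. subsemigrp B T}"
    and ord: "\<And>A B. subsemigrp A S \<Longrightarrow> subsemigrp B S \<Longrightarrow> A \<subseteq> B \<longleftrightarrow> \<Phi> A \<subseteq> \<Phi> B"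
    using iso by (simp_all add: lattice_isomorphism_def lattice_iso_def Sub_def)
  have \<Phi>'_Some: "\<Phi>' (Some ` A) = Some ` \<Phi> A" for A
    by (simp add: \<Phi>'_def inj_vimage_image_eq)
  interpret G: tf_sub_iso ?m ?n ?C ?D \<Phi>'
  proof (intro tf_sub_iso.intro sub_iso.intro sub_iso_axioms.intro tf_sub_iso_axioms.intro
      S.sgp_total_mul T.sgp_total_mul)
    show "mclosed ?m ?C" "mclosed ?n ?D"
      using mclosed_total_mul[OF subset_refl, of S] mclosed_total_mul[OF subset_refl, of T]
      by (simp_all add: subsemigrp_def S.smul_closed T.smul_closed)
    show "bij_betw \<Phi>' {A. A \<subseteq> ?C \<and> mclosed ?m A} {B. B \<subseteq> ?D \<and> mclosed ?n B}"
      unfolding closed_subsets_total_mul bij_betw_def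
    proof
      show "inj_on \<Phi>' ((`) Some ` {A. subsemigrp A S})"
        using bij_betw_imp_inj_on[OF bij]
        by (auto simp: inj_on_def \<Phi>'_Some inj_image_eq_iff)
      show "\<Phi>' ` (`) Some ` {A. subsemigrp A S} = (`) Some ` {B. subsemigrp B T}"
        unfolding bij_betw_imp_surj_on[OF bij, symmetric] by (simp add: image_image \<Phi>'_Some)
    qed
    show "A \<subseteq> A' \<longleftrightarrow> \<Phi>' A \<subseteq> \<Phi>' A'"
      if A: "A \<subseteq> ?C" "mclosed ?m A" "A' \<subseteq> ?C" "mclosed ?m A'" for A A'
    proof -
      have "A \<in> (`) Some ` {A. subsemigrp A S}" "A' \<in> (`) Some ` {A. subsemigrp A S}"
        unfolding closed_subsets_total_mul[symmetric] using A by simp_all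
      then obtain B B' where B: "subsemigrp B S" "A = Some ` B" "subsemigrp B' S" "A' = Some ` B'"
        by (elim imageE CollectE)
      show ?thesis
        unfolding B(2,4) \<Phi>'_Some inj_image_subset_iff[OF inj_Some] by (rule ord[OF B(1,3)])
    qed
    show "inj (pw ?m p)" if p: "p \<in> ?C" "?m p p \<noteq> p" for p
    proof -
      obtain x where x: "x \<in> carrier S" "p = Some x" using p(1) by blast
      then have "x \<notin> idempotents S" using p(2) by (auto simp: idempotents_def total_mul_Some)
      then have "infinite_order S x" using tf x(1) by (auto simp: torsion_free_def)
      then show ?thesis using S.infinite_order_iff_inj[OF x(1)] x(2) by simp
    qed
  qed
  have idem': "mclosed ?m {p \<in> ?C. ?m p p = p}"
    unfolding idempotents_total_mul using mclosed_total_mul idem by (metis subsemigrp_def)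
  have reg': "\<exists>q\<in>?C. ?m (?m p q) p = p" if p: "p \<in> ?C" for p
  proof -
    obtain x where x: "x \<in> carrier S" "p = Some x" using p by blast
    then obtain z where z: "z \<in> carrier S" "x \<cdot>\<^bsub>S\<^esub> z \<cdot>\<^bsub>S\<^esub> x = x"
      using reg unfolding regular_semigrp_def by blast
    have "?m (?m p (Some z)) p = p" using x z by (simp add: total_mul_Some S.smul_closed)
    then show ?thesis using z(1) by blast
  qed
  have "torsion_free T"
    unfolding torsion_free_def
  proof (intro conjI ballI T)
    fix t assume "t \<in> carrier T - idempotents T"
    then have t: "t \<in> carrier T" "t \<notin> idempotents T" by blast+
    then have "?n (Some t) (Some t) \<noteq> Some t" by (simp add: idempotents_def total_mul_Some)
    then have "inj (pw ?n (Some t))" using G.T_tf t(1) by blast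
    then show "infinite_order T t" using T.infinite_order_iff_inj[OF t(1)] by simp
  qed
  moreover have "regular_semigrp T"
    unfolding regular_semigrp_def
  proof (intro conjI ballI T)
    fix t assume t: "t \<in> carrier T"
    then obtain s where "s \<in> ?D" "?n (?n (Some t) s) (Some t) = Some t"
      using G.orthodox_image(2)[OF idem' reg', of "Some t"] by blast
    then show "\<exists>s\<in>carrier T. t \<cdot>\<^bsub>T\<^esub> s \<cdot>\<^bsub>T\<^esub> t = t"
      using t by (auto simp: total_mul_Some T.smul_closed)
  qed
  moreover have "subsemigrp (idempotents T) T"
  proof -
    have "idempotents T \<subseteq> carrier T" by (auto simp: idempotents_def)
    moreover have "mclosed ?n (Some ` idempotents T)"
      unfolding idempotents_total_mul[symmetric] by (rule G.orthodox_image(1)[OF idem' reg'])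
    ultimately show ?thesis by (simp add: mclosed_total_mul)
  qed
  ultimately show ?thesis by (simp add: torsion_free_orthodox_def orthodox_semigrp_def)
qed

theorem theorem3p3:
  shows "(\<forall>(S :: 'a sgrp) (T :: 'b sgrp) \<Phi>.
            torsion_free_orthodox S \<and> semigrp T \<and> lattice_isomorphism S T \<Phi>
              \<longrightarrow> torsion_free_orthodox T)
         \<and> lattice_closed (torsion_free_orthodox :: 'a sgrp \<Rightarrow> bool)
                         (torsion_free_orthodox :: 'b sgrp \<Rightarrow> bool)"
  using torsion_free_orthodox_image
  unfolding lattice_closed_def lattice_isomorphic_def by blast

end
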